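(* Let $m\ge 3$ be an integer. For $\boldsymbol{p}_m=(p_0,\dots,p_{m-1})\in(0,1)^m$, let $N(\boldsymbol{p}_m)$ be the number of distinct values among the velocities $v\big((p_{\tau(0)},p_{\tau(1)},\dots,p_{\tau(m-1)})\big)$, as $\tau$ ranges over all permutations of $\{0,1,\dots,m-1\}$. Then for Lebesgue-almost every $\boldsymbol{p}_m\in(0,1)^m$, \[N(\boldsymbol{p}_m)=\frac{m!}{2m}=\frac{(m-1)!}{2}.\] Moreover, $N(\boldsymbol{p}_m)\le (m-1)!/2$ for every $\boldsymbol{p}_m\in(0,1)^m$.
   Context: For $m\in\mathbb{N}$ (positive integers) and $\boldsymbol{p}_m=(p_0,\dots,p_{m-1})\in(0,1)^m$, the cyclic birth and death chain (CBD) with parameters $\boldsymbol{p}_m$ is the discrete-time, time-homogeneous Markov chain $X=(X_n)_{n\ge 0}$ on $\mathbb{Z}$ with transition probabilities $p_{i,i+1}=p_{i \bmod m}$ and $p_{i,i-1}=1-p_{i\bmod m}$ for every $i\in\mathbb{Z}$ (all other transition probabilities being $0$). Its velocity is $v(\boldsymbol{p}_m):=\lim_{n\to\infty}n^{-1}X_n$; this limit exists almost surely, is a deterministic constant, and does not depend on the starting state. *)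

theory Defs
  imports "HOL-Probability.Probability"
begin

text \<open>
  Discrete-time, time-homogeneous Markov chains with values in the integers and transition
  probabilities \<open>K i j\<close>; the initial distribution is arbitrary.
\<close>

definition markov_chain ::
  "'w measure \<Rightarrow> (int \<Rightarrow> int \<Rightarrow> real) \<Rightarrow> (nat \<Rightarrow> 'w \<Rightarrow> int) \<Rightarrow> bool" where
  "markov_chain M K X \<longleftrightarrow>
     prob_space M \<and>
     (\<forall>n. X n \<in> measurable M (count_space UNIV)) \<and>
     (\<forall>n (x :: nat \<Rightarrow> int).
        \<P>(\<omega> in M. \<forall>k\<le>n. X k \<omega> = x k) > 0 \<longrightarrow>
        \<P>(\<omega> in M. X (Suc n) \<omega> = x (Suc n) \<bar> \<forall>k\<le>n. X k \<omega> = x k) = K (x n) (x (Suc n)))"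

text \<open>
  A parameter vector of length \<open>m\<close> is a function on the natural numbers of which only the
  values at \<open>0, \<dots>, m - 1\<close> are relevant.
\<close>

definition cbd_trans :: "nat \<Rightarrow> (nat \<Rightarrow> real) \<Rightarrow> int \<Rightarrow> int \<Rightarrow> real" where
  "cbd_trans m p i j =
     (if j = i + 1 then p (nat (i mod int m))
      else if j = i - 1 then 1 - p (nat (i mod int m))
      else 0)"

text \<open>
  The velocity is the constant to which \<open>X\<^sub>n / n\<close> converges almost surely, for every chain with
  these transition probabilities and any initial distribution. Fixing the sample space type to
  be that of integer paths is no restriction: a chain on any probability space
  can be replaced by its law on path space.
\<close>

definition velocity :: "nat \<Rightarrow> (nat \<Rightarrow> real) \<Rightarrow> real" where
  "velocity m p =
     (THE v. \<forall>(M :: (nat \<Rightarrow> int) measure) X. markov_chain M (cbd_trans m p) X \<longrightarrow>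
        (AE \<omega> in M. (\<lambda>n. real_of_int (X n \<omega>) / real n) \<longlonglongrightarrow> v))"

definition num_velocities :: "nat \<Rightarrow> (nat \<Rightarrow> real) \<Rightarrow> nat" where
  "num_velocities m p = card {velocity m (p \<circ> \<tau>) | \<tau>. \<tau> permutes {..<m}}"

end

theory Submission
  imports Defs "HOL-Library.Discrete_Functions" "HOL-Number_Theory.Cong"
begin

text \<open>
  With \<open>\<rho> = (1 - p) / p\<close>, the Poisson equation of the chain has a bounded solution, with explicit
  velocity \<open>v = m (1 - R) / S\<close>, where \<open>R\<close> is the product of all \<open>\<rho>\<close> and \<open>S\<close> is a sum of
  products of the \<open>\<rho>\<close> over arcs of the cycle. Hence \<open>X\<^sub>n - n v\<close> is, up to a bounded
  correction, a martingale with bounded increments, and \<open>X\<^sub>n / n\<close> converges to \<open>v\<close>. The formula is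
  invariant under the \<open>2 m\<close> rotations and reflections of the cycle, so every velocity is attained by
  at least \<open>2 m\<close> permutations. Conversely, after multiplication with all \<open>p\<^sub>i\<close> the sum \<open>S\<close>
  is a multiaffine polynomial in the \<open>p\<^sub>i\<close>. Its coefficients at arcs of length 2 reveal which parameters are
  neighbours on the cycle, and this adjacency determines the permutation up to rotation and
  reflection. Two different such polynomials agree only on a null set.
\<close>

section \<open>The Poisson equation and its dihedral symmetry\<close>

definition cyc :: "nat \<Rightarrow> (nat \<Rightarrow> 'a) \<Rightarrow> int \<Rightarrow> 'a" where
  "cyc m q i = q (nat (i mod int m))"

definition odds :: "real \<Rightarrow> real" where
  "odds x = (1 - x) / x"

definition arc_sum :: "nat \<Rightarrow> (nat \<Rightarrow> real) \<Rightarrow> nat \<Rightarrow> real" where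
  "arc_sum m q k = (\<Sum>i<m. \<Prod>j<k. odds (cyc m q (int i + int j)))"

text \<open>Each length enters twice, as \<open>k\<close> and \<open>Suc k\<close>:
  \<open>1 / p = 1 + odds p\<close>, so an arc product with an extra factor \<open>1 / p\<close> at
  the next vertex is a product over the arc plus a product over its extension by that
  vertex.\<close>

definition arc_total :: "nat \<Rightarrow> (nat \<Rightarrow> real) \<Rightarrow> real" where
  "arc_total m q = (\<Sum>k<m. arc_sum m q k + arc_sum m q (Suc k))"

definition cbd_velocity :: "nat \<Rightarrow> (nat \<Rightarrow> real) \<Rightarrow> real" where
  "cbd_velocity m q = real m * (1 - (\<Prod>i<m. odds (q i))) / arc_total m q"

text \<open>Rotation by \<open>a\<close> for \<open>s = 1\<close>, a reflection for
  \<open>s = -1\<close>. The identity beyond \<open>m\<close> is what \<open>permutes\<close>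
  demands.\<close>

definition dihedral :: "nat \<Rightarrow> int \<Rightarrow> int \<Rightarrow> nat \<Rightarrow> nat" where
  "dihedral m s a i = (if i < m then nat ((a + s * int i) mod int m) else i)"

lemma cyc_cong: "i mod int m = j mod int m \<Longrightarrow> cyc m q i = cyc m q j"
  by (simp add: cyc_def)

lemma cyc_of_nat: "i < m \<Longrightarrow> cyc m q (int i) = q i"
  by (simp add: cyc_def)

lemma dihedral_permutes:
  assumes "m > 0" and "\<bar>s\<bar> = 1"
  shows "dihedral m s a permutes {..<m}"
proof -
  have less: "dihedral m s a i < m" if "i < m" for i
    using that assms by (simp add: dihedral_def nat_less_iff)
  have "inj_on (dihedral m s a) {..<m}"
  proof (rule inj_onI)
    fix i j assume ij: "i \<in> {..<m}" "j \<in> {..<m}" and eq: "dihedral m s a i = dihedral m s a j"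
    from eq ij assms have "(a + s * int i) mod int m = (a + s * int j) mod int m"
      by (simp add: dihedral_def nat_eq_iff2)
    then have "int m dvd s * (int i - int j)"
      by (simp add: mod_eq_dvd_iff algebra_simps)
    moreover from assms(2) have "s = 1 \<or> s = -1" by arith
    ultimately have "int m dvd int i - int j" by (auto simp: dvd_diff_commute)
    then have "int i mod int m = int j mod int m" by (simp add: mod_eq_dvd_iff)
    with ij show "i = j" by simp
  qed
  moreover from this have "dihedral m s a ` {..<m} = {..<m}"
    using less by (intro endo_inj_surj) auto
  ultimately have "bij_betw (dihedral m s a) {..<m} {..<m}"
    by (simp add: bij_betw_def)
  then show ?thesis
    by (rule bij_imp_permutes) (simp add: dihedral_def)
qed

lemma cyc_dihedral:
  assumes "m > 0"
  shows "cyc m (q \<circ> dihedral m s a) i = cyc m q (a + s * i)"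
proof -
  have "(a + s * (i mod int m)) mod int m = (a + s * i) mod int m"
    by (metis mod_add_right_eq mod_mult_right_eq)
  then show ?thesis
    using assms by (simp add: cyc_def dihedral_def nat_less_iff)
qed

lemma sum_cyclic_reindex:
  assumes "m > 0" and "\<bar>s\<bar> = 1" and "\<And>x y. x mod int m = y mod int m \<Longrightarrow> f x = f y"
  shows "(\<Sum>i<m. f (a + s * int i)) = (\<Sum>i<m. f (int i))"
proof -
  have "(\<Sum>i<m. f (int i)) = (\<Sum>i<m. f (int (dihedral m s a i)))"
    using sum.permute[OF dihedral_permutes[OF assms(1,2)], of "\<lambda>i. f (int i)"] by simp
  also have "\<dots> = (\<Sum>i<m. f (a + s * int i))"
    using assms(1) by (intro sum.cong refl assms(3)) (simp add: dihedral_def)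
  finally show ?thesis ..
qed

lemma prod_cyclic_reindex:
  assumes "m > 0" and "\<bar>s\<bar> = 1" and "\<And>x y. x mod int m = y mod int m \<Longrightarrow> f x = f y"
  shows "(\<Prod>i<m. f (a + s * int i)) = (\<Prod>i<m. f (int i))"
proof -
  have "(\<Prod>i<m. f (int i)) = (\<Prod>i<m. f (int (dihedral m s a i)))"
    using prod.permute[OF dihedral_permutes[OF assms(1,2)], of "\<lambda>i. f (int i)"] by simp
  also have "\<dots> = (\<Prod>i<m. f (a + s * int i))"
    using assms(1) by (intro prod.cong refl assms(3)) (simp add: dihedral_def)
  finally show ?thesis ..
qed

lemma arc_prod_cong:
  "x mod int m = y mod int m \<Longrightarrow>
    (\<Prod>j<k. odds (cyc m q (x + int j))) = (\<Prod>j<k. odds (cyc m q (y + int j)))"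
  by (intro prod.cong refl arg_cong[where f = odds] cyc_cong) (metis mod_add_left_eq)

lemma arc_prod_reverse:
  "(\<Prod>j<k. odds (cyc m q (x - int j))) = (\<Prod>j<k. odds (cyc m q (x - int k + 1 + int j)))"
  by (subst prod.nat_diff_reindex[symmetric]) (auto intro!: prod.cong simp: of_nat_diff algebra_simps)

text \<open>An arc of \<open>k\<close> vertices ending in \<open>i\<close> starts in
  \<open>i - k + 1\<close>; summing over the whole cycle absorbs the shift.\<close>

lemma sum_backward_arcs:
  assumes "m > 0"
  shows "(\<Sum>i<m. \<Prod>j<k. odds (cyc m q (int i - int j))) = arc_sum m q k"
proof -
  define F where "F x = (\<Prod>j<k. odds (cyc m q (x + int j)))" for x
  have "(\<Prod>j<k. odds (cyc m q (int i - int j))) = F ((1 - int k) + 1 * int i)" for i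
    unfolding arc_prod_reverse F_def by (simp add: algebra_simps)
  moreover have "(\<Sum>i<m. F ((1 - int k) + 1 * int i)) = (\<Sum>i<m. F (int i))"
    unfolding F_def by (rule sum_cyclic_reindex[OF assms _ arc_prod_cong]) auto
  ultimately show ?thesis
    by (simp add: arc_sum_def F_def)
qed

text \<open>Rotations move the starting points and reflections reverse the arcs, so the family of
  arcs of a given length stays the same.\<close>

lemma arc_sum_dihedral:
  assumes "m > 0" and "\<bar>s\<bar> = 1"
  shows "arc_sum m (q \<circ> dihedral m s a) k = arc_sum m q k"
proof -
  define F where "F x = (\<Prod>j<k. odds (cyc m q (x + s * int j)))" for x
  have "arc_sum m (q \<circ> dihedral m s a) k = (\<Sum>i<m. F (a + s * int i))"
    by (simp add: arc_sum_def F_def cyc_dihedral[OF assms(1)] algebra_simps)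
  also have "\<dots> = (\<Sum>i<m. F (int i))"
  proof (rule sum_cyclic_reindex[OF assms])
    show "F x = F y" if "x mod int m = y mod int m" for x y
      unfolding F_def using that
      by (intro prod.cong refl arg_cong[where f = odds] cyc_cong) (metis mod_add_left_eq)
  qed
  also have "\<dots> = arc_sum m q k"
  proof -
    have "s = 1 \<or> s = -1" using assms(2) by arith
    then show ?thesis
      using sum_backward_arcs[OF assms(1), of q k] by (auto simp: F_def arc_sum_def)
  qed
  finally show ?thesis .
qed

lemma odds_pos: "x \<in> {0<..<1} \<Longrightarrow> 0 < odds x"
  by (simp add: odds_def)

lemma cyc_mem: "\<lbrakk>m > 0; \<And>i. i < m \<Longrightarrow> q i \<in> S\<rbrakk> \<Longrightarrow> cyc m q x \<in> S"
  by (simp add: cyc_def nat_less_iff)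

lemma arc_total_pos:
  assumes "m > 0" and "\<And>i. i < m \<Longrightarrow> q i \<in> {0<..<1}"
  shows "0 < arc_total m q"
proof -
  have "0 < arc_sum m q k" for k
    unfolding arc_sum_def using assms
    by (intro sum_pos prod_pos odds_pos cyc_mem) auto
  then show ?thesis
    unfolding arc_total_def using assms(1) by (intro sum_pos add_pos_pos) auto
qed

text \<open>In terms of \<open>d x = 1 + h (x + 1) - h x\<close> the equation is the first-order
  recursion \<open>P x * d x - (1 - P x) * d (x - 1) = v\<close>, which has an explicit periodic
  solution.\<close>

lemma cbd_poisson_equation:
  assumes m: "m > 0" and q: "\<And>i. i < m \<Longrightarrow> q i \<in> {0<..<1}"
  obtains h :: "int \<Rightarrow> real" and B where "\<And>x. \<bar>h x\<bar> \<le> B"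
    and "\<And>x. cyc m q x * (1 + h (x + 1) - h x) + (1 - cyc m q x) * (-1 + h (x - 1) - h x)
              = cbd_velocity m q"
proof -
  define P where "P = cyc m q"
  define R where "R = (\<Prod>i<m. odds (q i))"
  define g where "g x k = (1 / P (x - int k)) * (\<Prod>j<k. odds (P (x - int j)))" for x k
  define T where "T x = (\<Sum>k<m. g x k)" for x
    \<comment> \<open>Unrolling \<open>d x = v / P x + odds (P x) * d (x - 1)\<close> once around the cycle gives
      \<open>(1 - R) * d x = v * T x\<close>; taking \<open>d\<close> proportional to \<open>T\<close> and \<open>v\<close> to \<open>1 - R\<close> covers \<open>R = 1\<close> too.\<close>
  have P: "0 < P x" "P x < 1" for x
    using cyc_mem[OF m q, where x = x] by (auto simp: P_def)
  have Pc: "P x = P y" if "x mod int m = y mod int m" for x y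
    unfolding P_def using that by (rule cyc_cong)
  have gc: "g x k = g y k" if "x mod int m = y mod int m" for x y k
    unfolding g_def using that
    by (intro arg_cong2[where f="(*)"] prod.cong refl arg_cong[where f = odds] arg_cong[where f = "\<lambda>x. 1 / x"] Pc)
       (metis mod_diff_left_eq)+
  then have Tc: "T x = T y" if "x mod int m = y mod int m" for x y
    unfolding T_def using that by (intro sum.cong refl)
  have full: "(\<Prod>j<m. odds (P (x - int j))) = R" for x
  proof -
    have "(\<Prod>j<m. odds (P (x + (-1) * int j))) = (\<Prod>j<m. odds (P (int j)))"
      using m by (intro prod_cyclic_reindex) (auto dest: Pc)
    then show ?thesis
      by (simp add: R_def P_def cyc_of_nat)
  qed
  have shift: "odds (P x) * g (x - 1) k = g x (Suc k)" for x k
    by (simp add: g_def prod.lessThan_Suc_shift algebra_simps del: prod.lessThan_Suc)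
  \<comment> \<open>By \<open>shift\<close> the difference telescopes; what remains is the empty
    product at \<open>k = 0\<close> and the full cycle at \<open>k = m\<close>.\<close>
  have rec: "T x - odds (P x) * T (x - 1) = (1 - R) / P x" for x
  proof -
    have "T x - odds (P x) * T (x - 1) = (\<Sum>k<m. g x k - g x (Suc k))"
      by (simp add: T_def sum_distrib_left shift sum_subtractf)
    also have "\<dots> = g x 0 - g x m"
      by (rule sum_lessThan_telescope')
    also have "g x m = R / P x"
      using Pc[of "x - int m" x] by (simp add: g_def full)
    finally show ?thesis by (simp add: g_def diff_divide_distrib)
  qed
  have total: "(\<Sum>i<m. T (int i)) = arc_total m q"
  proof -
    have "g x k = (\<Prod>j<k. odds (P (x - int j))) + (\<Prod>j<Suc k. odds (P (x - int j)))" for x k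
      using P(1)[of "x - int k"] by (simp add: g_def odds_def field_simps)
    then have "(\<Sum>i<m. g (int i) k) = arc_sum m q k + arc_sum m q (Suc k)" for k
      by (simp add: sum.distrib P_def sum_backward_arcs[OF m] del: prod.lessThan_Suc)
    then show ?thesis
      unfolding T_def by (subst sum.swap) (simp add: arc_total_def)
  qed
  have S: "arc_total m q > 0"
    using m q by (rule arc_total_pos)
  \<comment> \<open>The factor makes \<open>d\<close> sum to \<open>m\<close> over one period, so
    \<open>d - 1\<close> sums to zero there; hence its partial sums \<open>H\<close> close up and
    \<open>h\<close> is periodic and bounded.\<close>
  define d where "d x = real m * T x / arc_total m q" for x
  have dc: "d x = d y" if "x mod int m = y mod int m" for x y
    using Tc[OF that] by (simp add: d_def)
  have drift: "P x * d x - (1 - P x) * d (x - 1) = cbd_velocity m q" for x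
  proof -
    have "P x * T x - (1 - P x) * T (x - 1) = P x * (T x - odds (P x) * T (x - 1))"
      using P(1)[of x] by (simp add: odds_def field_simps)
    also have "\<dots> = 1 - R"
      using P(1)[of x] by (simp add: rec)
    finally have "P x * T x - (1 - P x) * T (x - 1) = 1 - R" .
    moreover have "P x * d x - (1 - P x) * d (x - 1) =
        real m * (P x * T x - (1 - P x) * T (x - 1)) / arc_total m q"
      by (simp add: d_def algebra_simps diff_divide_distrib add_divide_distrib)
    ultimately show ?thesis
      by (simp add: cbd_velocity_def R_def)
  qed
  define H where "H j = (\<Sum>i<j. d (int i) - 1)" for j :: nat
  have Hm: "H m = 0"
    using S by (simp add: H_def sum_subtractf d_def total flip: sum_divide_distrib sum_distrib_left)
  define h where "h x = H (nat (x mod int m))" for x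
  have step: "h (x + 1) = h x + d x - 1" for x
  proof -
    define j where "j = nat (x mod int m)"
    have j: "j < m" "int j = x mod int m" using m by (auto simp: j_def nat_less_iff)
    have dx: "d (int j) = d x" by (rule dc) (simp add: j)
    have "h (x + 1) = H (Suc j)"
    \<comment> \<open>Only the step from \<open>m - 1\<close> back to \<open>0\<close> needs
      \<open>Hm\<close>.\<close>
    proof (cases "Suc j = m")
      case True
      then have "int m = x mod int m + 1" using j by simp
      then have "(x + 1) mod int m = 0" by (metis mod_add_left_eq mod_self)
      then show ?thesis using True Hm by (simp add: h_def H_def)
    next
      case False
      have "(x + 1) mod int m = (int j + 1) mod int m" by (simp add: j mod_simps)
      also have "\<dots> = int j + 1" using False j(1) by simp
      finally show ?thesis by (simp add: h_def nat_add_distrib)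
    qed
    then show ?thesis by (simp add: H_def dx h_def j_def[symmetric])
  qed
  have step': "h (x - 1) = h x - d (x - 1) + 1" for x
    using step[of "x - 1"] by simp
  have "\<bar>h x\<bar> \<le> (\<Sum>j<m. \<bar>H j\<bar>)" for x
    unfolding h_def using m by (intro member_le_sum) (auto simp: nat_less_iff)
  moreover have "P x * (1 + h (x + 1) - h x) + (1 - P x) * (-1 + h (x - 1) - h x)
      = cbd_velocity m q" for x
    unfolding step step' using drift[of x] by (simp add: algebra_simps)
  ultimately show ?thesis
    using that[of h] unfolding P_def by blast
qed

section \<open>A law of large numbers for nearest-neighbour chains\<close>

lemma increments_sum_bound:
  fixes Z :: "nat \<Rightarrow> real"
  assumes "\<forall>n. \<bar>Z (Suc n) - Z n\<bar> \<le> C"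
  shows "\<bar>Z (n + k) - Z n\<bar> \<le> real k * C"
proof (induction k)
  case (Suc k)
  then show ?case
    using assms[rule_format, of "n + k"] by (simp add: algebra_simps)
qed simp

text \<open>If \<open>k\<^sup>2\<close> is the largest square up to \<open>n\<close>, then
  \<open>n\<close> exceeds it by at most \<open>2 * k\<close>, so \<open>Z\<close> changes by at
  most \<open>2 * k * C\<close> in between, which is negligible against
  \<open>k\<^sup>2\<close>.\<close>

lemma LIMSEQ_over_n_from_squares:
  fixes Z :: "nat \<Rightarrow> real"
  assumes incr: "\<forall>n. \<bar>Z (Suc n) - Z n\<bar> \<le> C"
    and squares: "(\<lambda>k. Z (k\<^sup>2) / (real k)\<^sup>2) \<longlonglongrightarrow> 0"
  shows "(\<lambda>n. Z n / real n) \<longlonglongrightarrow> 0"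
proof (rule Lim_null_comparison)
  have C: "0 \<le> C"
    using incr[rule_format, of 0] by linarith
  show "\<forall>\<^sub>F n in sequentially. norm (Z n / real n) \<le>
      \<bar>Z ((floor_sqrt n)\<^sup>2) / (real (floor_sqrt n))\<^sup>2\<bar> + 2 * C / real (floor_sqrt n)"
    using eventually_gt_at_top[of 0]
  proof eventually_elim
    case (elim n)
    define k where "k = floor_sqrt n"
    have k: "0 < k" "k\<^sup>2 \<le> n" "n < (Suc k)\<^sup>2"
      using elim Suc_floor_sqrt_power2_gt[of n] by (auto simp: k_def)
    have "\<bar>Z n - Z (k\<^sup>2)\<bar> \<le> real (n - k\<^sup>2) * C"
      using increments_sum_bound[OF incr, of "k\<^sup>2" "n - k\<^sup>2"] k(2) by simp
    also have "\<dots> \<le> (2 * real k) * C"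
    proof (rule mult_right_mono[OF _ C])
      have "n - k\<^sup>2 \<le> 2 * k" using k(3) by (simp add: power2_eq_square)
      then show "real (n - k\<^sup>2) \<le> 2 * real k" by linarith
    qed
    finally have "\<bar>Z n\<bar> \<le> \<bar>Z (k\<^sup>2)\<bar> + 2 * real k * C" by linarith
    then have "norm (Z n / real n) \<le> (\<bar>Z (k\<^sup>2)\<bar> + 2 * real k * C) / real n"
      by (simp add: divide_right_mono)
    also have "\<dots> \<le> (\<bar>Z (k\<^sup>2)\<bar> + 2 * real k * C) / (real k)\<^sup>2"
    proof (rule divide_left_mono)
      show "(real k)\<^sup>2 \<le> real n" using k(2) by (metis of_nat_le_iff of_nat_power)
    qed (use k C elim in auto)
    also have "\<dots> = \<bar>Z (k\<^sup>2) / (real k)\<^sup>2\<bar> + 2 * C / real k"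
      using k(1) by (simp add: field_simps power2_eq_square)
    finally show ?case by (simp add: k_def)
  qed
  have sqrt: "filterlim floor_sqrt sequentially sequentially"
    unfolding filterlim_at_top eventually_sequentially
    by (meson le_floor_sqrt_iff)
  have "(\<lambda>k. \<bar>Z (k\<^sup>2) / (real k)\<^sup>2\<bar> + 2 * C / real k) \<longlonglongrightarrow> 0 + 0"
    using squares by (intro tendsto_add lim_const_over_n tendsto_rabs_zero)
  then show "(\<lambda>n. \<bar>Z ((floor_sqrt n)\<^sup>2) / (real (floor_sqrt n))\<^sup>2\<bar> + 2 * C / real (floor_sqrt n)) \<longlonglongrightarrow> 0"
    using filterlim_compose[OF _ sqrt] by fastforce
qed


section \<open>Nearest-neighbour chains: the past and the next step\<close>

locale nearest_neighbour_chain =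
  fixes M :: "'w measure" and X :: "nat \<Rightarrow> 'w \<Rightarrow> int" and P :: "int \<Rightarrow> real"
  assumes chain: "markov_chain M (\<lambda>i j. if j = i + 1 then P i else if j = i - 1 then 1 - P i else 0) X"
    and P_nonneg: "0 \<le> P x" and P_le_1: "P x \<le> 1"
begin

sublocale prob_space M
  using chain by (simp add: markov_chain_def)

text \<open>Integer lists form a countable type, so a law of the past is determined by its point
  masses.\<close>

definition history :: "nat \<Rightarrow> 'w \<Rightarrow> int list" where
  "history n \<omega> = map (\<lambda>k. X k \<omega>) [0..<Suc n]"

lemma measurable_X [measurable]: "X n \<in> measurable M (count_space UNIV)"
  using chain by (simp add: markov_chain_def)

lemma history_eq_iff:
  "history n \<omega> = l \<longleftrightarrow> length l = Suc n \<and> (\<forall>k\<le>n. X k \<omega> = l ! k)"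
  by (auto simp: history_def list_eq_iff_nth_eq less_Suc_eq_le simp del: upt_Suc)

lemma measurable_history [measurable]: "history n \<in> measurable M (count_space UNIV)"
proof -
  have "history n -` {l} \<inter> space M = {\<omega> \<in> space M. length l = Suc n \<and> (\<forall>k\<le>n. X k \<omega> = l ! k)}" for l
    unfolding history_eq_iff[symmetric] by auto
  then show ?thesis
    by (simp add: measurable_count_space_eq2_countable)
qed

lemma hd_history: "hd (history n \<omega>) = X 0 \<omega>"
  and last_history: "last (history n \<omega>) = X n \<omega>"
  by (simp_all add: history_def hd_map del: upt_Suc) (simp add: last_map)

text \<open>The product form of the Markov property also covers histories of probability zero, where
  the conditional form says nothing: both sides vanish.\<close>

lemma prob_step:
  "prob {\<omega> \<in> space M. history n \<omega> = l \<and> X (Suc n) \<omega> = X n \<omega> + e} =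
    prob {\<omega> \<in> space M. history n \<omega> = l} *
      (if e = 1 then P (last l) else if e = -1 then 1 - P (last l) else 0)"
proof (cases "prob {\<omega> \<in> space M. history n \<omega> = l} = 0")
  case True
  have "prob {\<omega> \<in> space M. history n \<omega> = l \<and> X (Suc n) \<omega> = X n \<omega> + e} \<le> prob {\<omega> \<in> space M. history n \<omega> = l}"
    by (intro finite_measure_mono) auto
  with True show ?thesis
    by (simp add: measure_le_0_iff)
next
  case False
  then have pos: "prob {\<omega> \<in> space M. history n \<omega> = l} > 0"
    by (simp add: zero_less_measure_iff)
  have len: "length l = Suc n"
    using False by (cases "length l = Suc n") (simp_all add: history_eq_iff)
  then have last: "last l = l ! n"
    by (subst last_conv_nth) auto
  \<comment> \<open>The Markov property is stated for infinite sequences; this one follows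
    \<open>l\<close> up to time \<open>n\<close> and then moves by \<open>e\<close>.\<close>
  define x where "x k = (if k \<le> n then l ! k else last l + e)" for k
  have hist: "history n \<omega> = l \<longleftrightarrow> (\<forall>k\<le>n. X k \<omega> = x k)" for \<omega>
    by (simp add: history_eq_iff len x_def)
  have "cond_prob M (\<lambda>\<omega>. X (Suc n) \<omega> = x (Suc n)) (\<lambda>\<omega>. \<forall>k\<le>n. X k \<omega> = x k) =
      (if x (Suc n) = x n + 1 then P (x n) else if x (Suc n) = x n - 1 then 1 - P (x n) else 0)"
    using chain pos unfolding markov_chain_def hist by blast
  moreover have "{\<omega> \<in> space M. history n \<omega> = l \<and> X (Suc n) \<omega> = X n \<omega> + e} =
      {\<omega> \<in> space M. X (Suc n) \<omega> = x (Suc n) \<and> (\<forall>k\<le>n. X k \<omega> = x k)}"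
    unfolding hist by (auto simp: x_def last)
  ultimately show ?thesis
    using pos by (simp add: cond_prob_def hist x_def last field_simps)
qed

text \<open>Against a function of the past, the indicator of a step may be replaced by its
  conditional probability. Weighting \<open>M\<close> by either of them gives the same image measure
  under \<open>history n\<close>, which yields the identity for all \<open>G\<close> at
  once.\<close>

lemma integral_step:
  fixes G :: "int list \<Rightarrow> real"
  assumes kappa: "\<And>x. \<kappa> x = (if e = 1 then P x else if e = -1 then 1 - P x else 0)"
  shows "(\<integral>\<omega>. G (history n \<omega>) * of_bool (X (Suc n) \<omega> = X n \<omega> + e) \<partial>M) =
    (\<integral>\<omega>. G (history n \<omega>) * \<kappa> (X n \<omega>) \<partial>M)"
proof -
  let ?U = "\<lambda>\<omega>. of_bool (X (Suc n) \<omega> = X n \<omega> + e) :: real"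
  have kappa_nonneg: "0 \<le> \<kappa> x" for x
    using P_nonneg P_le_1 by (simp add: kappa)
  have [measurable]: "(\<lambda>\<omega>. \<kappa> (X n \<omega>)) \<in> borel_measurable M"
    by (rule measurable_compose[OF measurable_X]) simp
  have [measurable]: "?U \<in> borel_measurable M"
    by measurable
  have "distr (density M ?U) (count_space UNIV) (history n) =
      distr (density M (\<lambda>\<omega>. \<kappa> (X n \<omega>))) (count_space UNIV) (history n)"
  proof (rule measure_eqI_countable[where A = UNIV])
    fix l :: "int list"
    have H: "history n -` {l} \<inter> space M = {\<omega> \<in> space M. history n \<omega> = l}" by auto
    have [measurable]: "{\<omega> \<in> space M. history n \<omega> = l} \<in> sets M"
      by measurable
    have "emeasure (distr (density M ?U) (count_space UNIV) (history n)) {l} =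
        (\<integral>\<^sup>+\<omega>. ennreal (?U \<omega>) * indicator {\<omega> \<in> space M. history n \<omega> = l} \<omega> \<partial>M)"
      by (simp add: emeasure_distr emeasure_density H)
    also have "\<dots> = (\<integral>\<^sup>+\<omega>. indicator {\<omega> \<in> space M. history n \<omega> = l \<and> X (Suc n) \<omega> = X n \<omega> + e} \<omega> \<partial>M)"
      by (intro nn_integral_cong) (auto split: split_indicator)
    also have "\<dots> = ennreal (prob {\<omega> \<in> space M. history n \<omega> = l} * \<kappa> (last l))"
      by (simp add: emeasure_eq_measure prob_step kappa)
    also have "\<dots> = (\<integral>\<^sup>+\<omega>. ennreal (\<kappa> (last l)) * indicator {\<omega> \<in> space M. history n \<omega> = l} \<omega> \<partial>M)"
      by (simp add: nn_integral_cmult_indicator emeasure_eq_measure ennreal_mult' kappa_nonneg mult.commute)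
    also have "\<dots> = (\<integral>\<^sup>+\<omega>. ennreal (\<kappa> (X n \<omega>)) * indicator {\<omega> \<in> space M. history n \<omega> = l} \<omega> \<partial>M)"
      by (intro nn_integral_cong) (auto split: split_indicator simp: last_history)
    also have "\<dots> = emeasure (distr (density M (\<lambda>\<omega>. \<kappa> (X n \<omega>))) (count_space UNIV) (history n)) {l}"
      by (simp add: emeasure_distr emeasure_density H)
    finally show "emeasure (distr (density M ?U) (count_space UNIV) (history n)) {l} =
      emeasure (distr (density M (\<lambda>\<omega>. \<kappa> (X n \<omega>))) (count_space UNIV) (history n)) {l}" .
  qed auto
  then have "(\<integral>l. G l \<partial>distr (density M ?U) (count_space UNIV) (history n)) =
      (\<integral>l. G l \<partial>distr (density M (\<lambda>\<omega>. \<kappa> (X n \<omega>))) (count_space UNIV) (history n))"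
    by simp
  then show ?thesis
    using kappa_nonneg by (simp add: integral_distr integral_real_density mult.commute)
qed

text \<open>By \<open>integral_step\<close> with \<open>G = 1\<close>, the two step events have
  probabilities adding up to 1.\<close>

lemma AE_step: "AE \<omega> in M. \<forall>n. X (Suc n) \<omega> = X n \<omega> + 1 \<or> X (Suc n) \<omega> = X n \<omega> - 1"
proof (subst AE_all_countable, rule allI)
  fix n
  let ?U = "\<lambda>e. {\<omega> \<in> space M. X (Suc n) \<omega> = X n \<omega> + e}"
  have U: "prob (?U e) = (\<integral>\<omega>. of_bool (X (Suc n) \<omega> = X n \<omega> + e) \<partial>M)" for e
  proof -
    have "(\<integral>\<omega>. of_bool (X (Suc n) \<omega> = X n \<omega> + e) \<partial>M) = (\<integral>\<omega>. indicator (?U e) \<omega> \<partial>M)"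
      by (intro Bochner_Integration.integral_cong) auto
    also have "\<dots> = prob (?U e \<inter> space M)"
      by (rule Bochner_Integration.integral_indicator)
    also have "?U e \<inter> space M = ?U e" by auto
    finally show ?thesis ..
  qed
  have int: "integrable M (\<lambda>\<omega>. P (X n \<omega>))"
    by (rule integrable_const_bound[where B = 1])
       (auto simp: P_nonneg P_le_1 intro: measurable_compose[OF measurable_X])
  have "prob (?U 1 \<union> ?U (-1)) = prob (?U 1) + prob (?U (-1))"
    by (rule finite_measure_Union) auto
  also have "\<dots> = (\<integral>\<omega>. P (X n \<omega>) \<partial>M) + (\<integral>\<omega>. 1 - P (X n \<omega>) \<partial>M)"
    using integral_step[of P 1 "\<lambda>_. 1" n] integral_step[of "\<lambda>x. 1 - P x" "-1" "\<lambda>_. 1" n]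
    by (simp only: U mult_1) simp
  also have "\<dots> = 1"
    using int by (simp add: prob_space)
  finally have "AE \<omega> in M. \<omega> \<in> ?U 1 \<union> ?U (-1)"
    by (intro AE_prob_1)
  then show "AE \<omega> in M. X (Suc n) \<omega> = X n \<omega> + 1 \<or> X (Suc n) \<omega> = X n \<omega> - 1"
    by eventually_elim auto
qed

section \<open>The corrected walk as a martingale with bounded increments\<close>

context
  fixes h :: "int \<Rightarrow> real" and B v :: real
  assumes h_bound: "\<And>x. \<bar>h x\<bar> \<le> B"
    and poisson: "\<And>x. P x * (1 + h (x + 1) - h x) + (1 - P x) * (-1 + h (x - 1) - h x) = v"
begin

text \<open>
  \<open>corrected n\<close> is a martingale started at 0: the bounded corrector \<open>h\<close> solves the Poisson equation
  of the chain, so the conditional mean of every increment of \<open>X\<^sub>n + h (X\<^sub>n)\<close> is \<open>v\<close>.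
\<close>

definition corrected :: "nat \<Rightarrow> 'w \<Rightarrow> real" where
  "corrected n \<omega> = real_of_int (X n \<omega> - X 0 \<omega>) + h (X n \<omega>) - h (X 0 \<omega>) - real n * v"

definition increment_bound :: real where
  "increment_bound = 1 + 2 * B + \<bar>v\<bar>"

lemma increment_bound_nonneg: "0 \<le> increment_bound"
  using h_bound[of 0] by (simp add: increment_bound_def)

lemma measurable_corrected [measurable]: "corrected n \<in> borel_measurable M"
proof -
  have [measurable]: "(\<lambda>\<omega>. h (X k \<omega>)) \<in> borel_measurable M" for k
    by (rule measurable_compose[OF measurable_X]) simp
  have [measurable]: "(\<lambda>\<omega>. real_of_int (X k \<omega>)) \<in> borel_measurable M" for k
    by (rule measurable_compose[OF measurable_X]) simp
  have "corrected n = (\<lambda>\<omega>. real_of_int (X n \<omega>) - real_of_int (X 0 \<omega>) + h (X n \<omega>) - h (X 0 \<omega>) - real n * v)"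
    by (simp add: corrected_def fun_eq_iff)
  then show ?thesis
    by simp
qed

lemma AE_increment:
  "AE \<omega> in M. \<forall>n. \<bar>corrected (Suc n) \<omega> - corrected n \<omega>\<bar> \<le> increment_bound"
  using AE_step
proof eventually_elim
  case (elim \<omega>)
  show ?case
  proof
    fix n
    show "\<bar>corrected (Suc n) \<omega> - corrected n \<omega>\<bar> \<le> increment_bound"
      using elim[rule_format, of n] h_bound[of "X n \<omega>"] h_bound[of "X (Suc n) \<omega>"]
      by (auto simp: corrected_def increment_bound_def algebra_simps)
  qed
qed

lemma AE_corrected_bound: "AE \<omega> in M. \<bar>corrected n \<omega>\<bar> \<le> real n * increment_bound"
  using AE_increment
proof eventually_elim
  case (elim \<omega>)
  show ?case
    using increments_sum_bound[OF elim, of 0 n] by (simp add: corrected_def)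
qed

text \<open>The increment is a function of the current position and of the step direction. Averaging
  the direction given the past yields 0 by the Poisson equation.\<close>

lemma corrected_orthogonal:
  "(\<integral>\<omega>. corrected n \<omega> * (corrected (Suc n) \<omega> - corrected n \<omega>) \<partial>M) = 0"
proof -
  \<comment> \<open>\<open>a\<close> and \<open>b\<close> are the increments of
    \<open>corrected\<close> on a step up and down; \<open>Z\<close> writes
    \<open>corrected n\<close> as a function of the history, as \<open>integral_step\<close>
    requires.\<close>
  define a where "a x = 1 + h (x + 1) - h x - v" for x
  define b where "b x = -1 + h (x - 1) - h x - v" for x
  define Z where "Z l = real_of_int (last l - hd l) + h (last l) - h (hd l) - real n * v" for l
  have Z: "Z (history n \<omega>) = corrected n \<omega>" for \<omega>
    by (simp add: Z_def corrected_def last_history hd_history)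
  have bounded: "\<bar>a x\<bar> \<le> increment_bound" "\<bar>b x\<bar> \<le> increment_bound" for x
    using h_bound[of x] h_bound[of "x + 1"] h_bound[of "x - 1"]
    by (auto simp: a_def b_def increment_bound_def)
  \<comment> \<open>The weight \<open>w\<close> stands for the step indicators as well as for the
    transition probabilities.\<close>
  have int: "integrable M (\<lambda>\<omega>. corrected n \<omega> * c (X n \<omega>) * w \<omega>)"
    if "\<And>x. \<bar>c x\<bar> \<le> increment_bound" "\<And>\<omega>. \<bar>w \<omega>\<bar> \<le> 1" and [measurable]: "w \<in> borel_measurable M" for c :: "int \<Rightarrow> real" and w
  proof (rule integrable_const_bound)
    have "AE \<omega> in M. \<bar>corrected n \<omega>\<bar> * \<bar>c (X n \<omega>)\<bar> * \<bar>w \<omega>\<bar> \<le> real n * increment_bound * increment_bound * 1"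
      using AE_corrected_bound
      by eventually_elim (intro mult_mono that, auto simp: increment_bound_nonneg)
    then show "AE \<omega> in M. norm (corrected n \<omega> * c (X n \<omega>) * w \<omega>) \<le> real n * increment_bound * increment_bound * 1"
      by (simp add: abs_mult)
    have [measurable]: "(\<lambda>\<omega>. c (X n \<omega>)) \<in> borel_measurable M"
      by (rule measurable_compose[OF measurable_X]) simp
    show "(\<lambda>\<omega>. corrected n \<omega> * c (X n \<omega>) * w \<omega>) \<in> borel_measurable M"
      by measurable
  qed
  let ?U = "\<lambda>e \<omega>. of_bool (X (Suc n) \<omega> = X n \<omega> + e) :: real"
  have PX [measurable]: "(\<lambda>\<omega>. P (X n \<omega>)) \<in> borel_measurable M"
    by (rule measurable_compose[OF measurable_X]) simp
  have "(\<integral>\<omega>. corrected n \<omega> * (corrected (Suc n) \<omega> - corrected n \<omega>) \<partial>M) =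
      (\<integral>\<omega>. corrected n \<omega> * a (X n \<omega>) * ?U 1 \<omega> + corrected n \<omega> * b (X n \<omega>) * ?U (-1) \<omega> \<partial>M)"
  proof (rule integral_cong_AE)
    have [measurable]: "(\<lambda>\<omega>. a (X n \<omega>)) \<in> borel_measurable M" "(\<lambda>\<omega>. b (X n \<omega>)) \<in> borel_measurable M"
      by (rule measurable_compose[OF measurable_X]; simp)+
    show "(\<lambda>\<omega>. corrected n \<omega> * a (X n \<omega>) * ?U 1 \<omega> + corrected n \<omega> * b (X n \<omega>) * ?U (-1) \<omega>) \<in> borel_measurable M"
      by measurable
    show "AE \<omega> in M. corrected n \<omega> * (corrected (Suc n) \<omega> - corrected n \<omega>) =
        corrected n \<omega> * a (X n \<omega>) * ?U 1 \<omega> + corrected n \<omega> * b (X n \<omega>) * ?U (-1) \<omega>"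
      using AE_step
    proof eventually_elim
      case (elim \<omega>)
      have "corrected (Suc n) \<omega> - corrected n \<omega> = a (X n \<omega>) * ?U 1 \<omega> + b (X n \<omega>) * ?U (-1) \<omega>"
        using elim[rule_format, of n]
      proof
        assume e: "X (Suc n) \<omega> = X n \<omega> + 1"
        show ?thesis by (simp add: e corrected_def a_def algebra_simps)
      next
        assume e: "X (Suc n) \<omega> = X n \<omega> - 1"
        show ?thesis by (simp add: e corrected_def b_def) (simp add: algebra_simps)
      qed
      then show ?case by (simp add: distrib_left mult.assoc)
    qed
  qed measurable
  also have "\<dots> = (\<integral>\<omega>. corrected n \<omega> * a (X n \<omega>) * ?U 1 \<omega> \<partial>M) + (\<integral>\<omega>. corrected n \<omega> * b (X n \<omega>) * ?U (-1) \<omega> \<partial>M)"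
    by (rule Bochner_Integration.integral_add; rule int; simp add: bounded)
  also have "\<dots> = (\<integral>\<omega>. corrected n \<omega> * a (X n \<omega>) * P (X n \<omega>) \<partial>M) +
      (\<integral>\<omega>. corrected n \<omega> * b (X n \<omega>) * (1 - P (X n \<omega>)) \<partial>M)"
    using integral_step[of P 1 "\<lambda>l. Z l * a (last l)" n]
      integral_step[of "\<lambda>x. 1 - P x" "-1" "\<lambda>l. Z l * b (last l)" n]
    by (simp add: Z last_history)
  also have "\<dots> = (\<integral>\<omega>. corrected n \<omega> * a (X n \<omega>) * P (X n \<omega>) + corrected n \<omega> * b (X n \<omega>) * (1 - P (X n \<omega>)) \<partial>M)"
    by (rule Bochner_Integration.integral_add[symmetric]; rule int)
       (auto simp: bounded P_nonneg P_le_1)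
  also have "\<dots> = 0"
  proof -
    have "a x * P x + b x * (1 - P x) = 0" for x
      using poisson[of x] by (simp add: a_def b_def algebra_simps)
    then have "corrected n \<omega> * a (X n \<omega>) * P (X n \<omega>) + corrected n \<omega> * b (X n \<omega>) * (1 - P (X n \<omega>)) = 0" for \<omega>
      by (metis distrib_left mult.assoc mult_zero_right)
    then show ?thesis by simp
  qed
  finally show ?thesis .
qed

text \<open>Orthogonality removes the cross term of the square, so each step adds at most
  \<open>increment_bound\<^sup>2\<close>.\<close>

lemma corrected_second_moment:
  "(\<integral>\<omega>. (corrected n \<omega>)\<^sup>2 \<partial>M) \<le> real n * increment_bound\<^sup>2"
proof (induction n)
  case 0
  then show ?case by (simp add: corrected_def)
next
  case (Suc n)
  let ?D = "\<lambda>\<omega>. corrected (Suc n) \<omega> - corrected n \<omega>"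
  have D_bound: "AE \<omega> in M. \<bar>?D \<omega>\<bar> \<le> increment_bound"
    using AE_increment by eventually_elim simp
  have D2_bound: "AE \<omega> in M. (?D \<omega>)\<^sup>2 \<le> increment_bound\<^sup>2"
    using D_bound by eventually_elim (simp add: abs_le_square_iff[symmetric] increment_bound_nonneg)
  have int: "integrable M (\<lambda>\<omega>. (corrected n \<omega>)\<^sup>2)"
  proof (rule integrable_const_bound)
    show "AE \<omega> in M. norm ((corrected n \<omega>)\<^sup>2) \<le> (real n * increment_bound)\<^sup>2"
      using AE_corrected_bound
      by eventually_elim (simp add: abs_le_square_iff[symmetric] increment_bound_nonneg)
  qed measurable
  have intD: "integrable M (\<lambda>\<omega>. (?D \<omega>)\<^sup>2)"
    using D2_bound by (intro integrable_const_bound[where B = "increment_bound\<^sup>2"]) simp_all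
  have intZD: "integrable M (\<lambda>\<omega>. corrected n \<omega> * ?D \<omega>)"
  proof (rule integrable_const_bound)
    show "AE \<omega> in M. norm (corrected n \<omega> * ?D \<omega>) \<le> (real n * increment_bound) * increment_bound"
      using AE_corrected_bound[of n] D_bound
      by eventually_elim (simp only: real_norm_def abs_mult, intro mult_mono, auto simp: increment_bound_nonneg)
  qed measurable
  have "(\<integral>\<omega>. (corrected (Suc n) \<omega>)\<^sup>2 \<partial>M) =
      (\<integral>\<omega>. (corrected n \<omega>)\<^sup>2 + 2 * (corrected n \<omega> * ?D \<omega>) + (?D \<omega>)\<^sup>2 \<partial>M)"
    by (intro Bochner_Integration.integral_cong refl) (simp add: power2_eq_square algebra_simps)
  also have "\<dots> = (\<integral>\<omega>. (corrected n \<omega>)\<^sup>2 \<partial>M) + (\<integral>\<omega>. (?D \<omega>)\<^sup>2 \<partial>M)"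
    using int intD intZD corrected_orthogonal by (simp add: Bochner_Integration.integral_add)
  also have "(\<integral>\<omega>. (?D \<omega>)\<^sup>2 \<partial>M) \<le> increment_bound\<^sup>2"
    using integral_le_const[OF intD D2_bound] .
  finally show ?case
    using Suc by (simp add: algebra_simps)
qed

text \<open>Along the squares the second moments are at most a constant over
  \<open>k\<^sup>2\<close>, hence summable. So the series of squared terms is almost surely finite
  and its terms tend to 0. At \<open>k = 0\<close> everything is 0, as division by zero gives
  0.\<close>

lemma AE_corrected_squares: "AE \<omega> in M. (\<lambda>k. corrected (k\<^sup>2) \<omega> / (real k)\<^sup>2) \<longlonglongrightarrow> 0"
proof -
  let ?f = "\<lambda>k \<omega>. ennreal ((corrected (k\<^sup>2) \<omega> / (real k)\<^sup>2)\<^sup>2)"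
  have "(\<integral>\<^sup>+\<omega>. ?f k \<omega> \<partial>M) \<le> ennreal (increment_bound\<^sup>2 * (1 / (real k)\<^sup>2))" for k
  proof -
    have "integrable M (\<lambda>\<omega>. (corrected (k\<^sup>2) \<omega> / (real k)\<^sup>2)\<^sup>2)"
    proof (rule integrable_const_bound)
      show "AE \<omega> in M. norm ((corrected (k\<^sup>2) \<omega> / (real k)\<^sup>2)\<^sup>2) \<le> (real (k\<^sup>2) * increment_bound)\<^sup>2 / ((real k)\<^sup>2)\<^sup>2"
        using AE_corrected_bound[of "k\<^sup>2"]
      proof eventually_elim
        case (elim \<omega>)
        have "(corrected (k\<^sup>2) \<omega>)\<^sup>2 \<le> (real (k\<^sup>2) * increment_bound)\<^sup>2"
          using elim by (simp add: abs_le_square_iff[symmetric] increment_bound_nonneg)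
        then show ?case by (simp add: power_divide divide_right_mono)
      qed
    qed measurable
    then have "(\<integral>\<^sup>+\<omega>. ?f k \<omega> \<partial>M) = ennreal (\<integral>\<omega>. (corrected (k\<^sup>2) \<omega> / (real k)\<^sup>2)\<^sup>2 \<partial>M)"
      by (intro nn_integral_eq_integral) auto
    also have "(\<integral>\<omega>. (corrected (k\<^sup>2) \<omega> / (real k)\<^sup>2)\<^sup>2 \<partial>M) = (\<integral>\<omega>. (corrected (k\<^sup>2) \<omega>)\<^sup>2 \<partial>M) / ((real k)\<^sup>2)\<^sup>2"
      by (simp add: power_divide)
    also have "\<dots> \<le> real (k\<^sup>2) * increment_bound\<^sup>2 / ((real k)\<^sup>2)\<^sup>2"
      by (intro divide_right_mono corrected_second_moment) simp
    also have "\<dots> = increment_bound\<^sup>2 * (1 / (real k)\<^sup>2)"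
      by (simp add: power2_eq_square)
    finally show ?thesis
      by (simp add: ennreal_leI)
  qed
  moreover have summable: "summable (\<lambda>k. increment_bound\<^sup>2 * (1 / (real k)\<^sup>2))"
    by (intro summable_mult) (use inverse_power_summable[of 2] in \<open>simp add: divide_inverse\<close>)
  ultimately have "(\<Sum>k. \<integral>\<^sup>+\<omega>. ?f k \<omega> \<partial>M) \<le> (\<Sum>k. ennreal (increment_bound\<^sup>2 * (1 / (real k)\<^sup>2)))"
    by (intro suminf_le) auto
  also have "\<dots> = ennreal (\<Sum>k. increment_bound\<^sup>2 * (1 / (real k)\<^sup>2))"
    by (intro suminf_ennreal2 summable) simp
  also have "\<dots> < \<infinity>" by simp
  finally have "(\<integral>\<^sup>+\<omega>. (\<Sum>k. ?f k \<omega>) \<partial>M) < \<infinity>"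
    by (subst nn_integral_suminf) auto
  then have "AE \<omega> in M. (\<Sum>k. ?f k \<omega>) \<noteq> \<infinity>"
    by (intro nn_integral_PInf_AE) auto
  then show ?thesis
  proof eventually_elim
    case (elim \<omega>)
    then have "summable (\<lambda>k. (corrected (k\<^sup>2) \<omega> / (real k)\<^sup>2)\<^sup>2)"
      by (intro summable_suminf_not_top) auto
    then have "(\<lambda>k. (corrected (k\<^sup>2) \<omega> / (real k)\<^sup>2)\<^sup>2) \<longlonglongrightarrow> 0"
      by (rule summable_LIMSEQ_zero)
    then show ?case
      by (simp add: tendsto_null_power)
  qed
qed


lemma AE_corrected_LIMSEQ: "AE \<omega> in M. (\<lambda>n. corrected n \<omega> / real n) \<longlonglongrightarrow> 0"
  using AE_increment AE_corrected_squares
  by eventually_elim (rule LIMSEQ_over_n_from_squares)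

lemma AE_velocity: "AE \<omega> in M. (\<lambda>n. real_of_int (X n \<omega>) / real n) \<longlonglongrightarrow> v"
  using AE_corrected_LIMSEQ
proof eventually_elim
  case (elim \<omega>)
  \<comment> \<open>What separates \<open>corrected n\<close> from \<open>X n - n * v\<close>; it is
    bounded in \<open>n\<close> for fixed \<open>\<omega>\<close>.\<close>
  define e where "e n = real_of_int (X 0 \<omega>) - h (X n \<omega>) + h (X 0 \<omega>)" for n
  have "(\<lambda>n. e n / real n) \<longlonglongrightarrow> 0"
  proof (rule Lim_null_comparison)
    have "\<bar>e n\<bar> \<le> \<bar>real_of_int (X 0 \<omega>)\<bar> + 2 * B" for n
      using h_bound[of "X n \<omega>"] h_bound[of "X 0 \<omega>"] by (simp add: e_def abs_if split: if_splits)
    then show "\<forall>\<^sub>F n in sequentially. norm (e n / real n) \<le> (\<bar>real_of_int (X 0 \<omega>)\<bar> + 2 * B) / real n"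
      by (intro always_eventually allI) (simp add: divide_right_mono)
  qed (rule lim_const_over_n)
  then have "(\<lambda>n. corrected n \<omega> / real n + e n / real n + v) \<longlonglongrightarrow> 0 + 0 + v"
    by (intro tendsto_add elim tendsto_const)
  moreover have "\<forall>\<^sub>F n in sequentially.
      corrected n \<omega> / real n + e n / real n + v = real_of_int (X n \<omega>) / real n"
    using eventually_gt_at_top[of 0]
    by eventually_elim (simp add: corrected_def e_def field_simps)
  ultimately show ?case
    by (simp add: filterlim_cong[OF refl refl])
qed

end

end

section \<open>Existence of the chain from independent uniform variables\<close>

primrec walk :: "(int \<Rightarrow> real) \<Rightarrow> (nat \<Rightarrow> real) \<Rightarrow> nat \<Rightarrow> int" where
  "walk P u 0 = 0"
| "walk P u (Suc n) = walk P u n + (if u n < P (walk P u n) then 1 else -1)"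

text \<open>Needed for the uniqueness in the definition of \<open>velocity\<close>: if there were no
  chain, every \<open>v\<close> would satisfy its condition vacuously. The walk is driven by
  independent uniform variables on \<open>[0, 1]\<close>, and its law is taken on path
  space.\<close>

lemma nearest_neighbour_chain_exists:
  fixes P :: "int \<Rightarrow> real"
  assumes P: "\<And>x. 0 \<le> P x" "\<And>x. P x \<le> 1"
  obtains M :: "(nat \<Rightarrow> int) measure" and X where
    "markov_chain M (\<lambda>i j. if j = i + 1 then P i else if j = i - 1 then 1 - P i else 0) X"
proof -
  define U where "U = uniform_measure lborel {0..1::real}"
  define K where "K i j = (if j = i + 1 then P i else if j = i - 1 then 1 - P i else 0)" for i j
  interpret U: prob_space U
    unfolding U_def by (rule prob_space_uniform_measure) auto
  have sets_U [measurable_cong, simp]: "sets U = sets borel"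
    by (simp add: U_def)
  have space_U [simp]: "space U = UNIV"
    by (simp add: U_def)
  interpret N: product_prob_space "\<lambda>_::nat. U" UNIV
    by unfold_locales
  define N where "N = PiM UNIV (\<lambda>_::nat. U)"
  define M where "M = distr N (PiM UNIV (\<lambda>_::nat. count_space (UNIV :: int set))) (walk P)"
  have space_N [simp]: "space N = UNIV"
    by (simp add: N_def space_PiM)
  have space_M [simp]: "space M = UNIV"
    by (simp add: M_def space_PiM)
  have sets_M [measurable_cong]: "sets M = sets (PiM UNIV (\<lambda>_::nat. count_space (UNIV :: int set)))"
    by (simp add: M_def)
  have walk_n: "(\<lambda>u. walk P u n) \<in> measurable N (count_space UNIV)" for n
  proof (induction n)
    case (Suc n)
    have "(\<lambda>u. (if u n < P i then 1 else -1) :: int) \<in> measurable N (count_space UNIV)" for i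
      unfolding N_def by measurable
    then have "(\<lambda>u. i + (if u n < P i then 1 else -1)) \<in> measurable N (count_space UNIV)" for i
      by (rule measurable_compose) simp
    from measurable_compose_countable[OF this Suc] show ?case by simp
  qed simp
  have walk [measurable]: "walk P \<in> measurable N (PiM UNIV (\<lambda>_::nat. count_space (UNIV :: int set)))"
    using measurable_abs_UNIV[where f = "\<lambda>n u. walk P u n", OF walk_n] by simp
  have step: "measure U {r. i + (if r < P i then 1 else -1) = j} = K i j" for i j
  proof -
    have *: "measure U A = measure lborel ({0..1} \<inter> A)" if "A \<in> sets borel" for A
      using that unfolding U_def by (subst measure_uniform_measure) auto
    consider "j = i + 1" | "j = i - 1" | "j \<noteq> i + 1" "j \<noteq> i - 1" by blast
    then show ?thesis
    proof cases
      case 1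
      then have "{r. i + (if r < P i then 1 else -1) = j} = {..<P i}" by auto
      moreover have "{0..1} \<inter> {..<P i} = {0..<P i}" using P(2)[of i] by auto
      ultimately show ?thesis using P(1)[of i] 1 by (simp add: * K_def)
    next
      case 2
      then have "{r. i + (if r < P i then 1 else -1) = j} = {P i..}" by auto
      moreover have "{0..1} \<inter> {P i..} = {P i..1}" using P(1)[of i] by auto
      ultimately show ?thesis using P(2)[of i] 2 by (simp add: * K_def)
    next
      case 3
      then have "{r. i + (if r < P i then 1 else -1) = j} = {}" by auto
      then show ?thesis using 3 by (simp add: K_def)
    qed
  qed
  \<comment> \<open>A path from 0 is followed up to time \<open>n\<close> iff each
    \<open>u k\<close> with \<open>k < n\<close> lies in the set \<open>A k\<close> that causes the
    \<open>k\<close>-th step, and the coordinates \<open>u k\<close> are independent.\<close>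
  have path: "measure M {\<omega>. \<forall>k\<le>n. \<omega> k = x k} = of_bool (x 0 = 0) * (\<Prod>k<n. K (x k) (x (Suc k)))"
    for n and x :: "nat \<Rightarrow> int"
  proof -
    define A where "A k = {r. x k + (if r < P (x k) then 1 else -1) = x (Suc k)}" for k
    have A: "A k \<in> sets U" for k
      unfolding A_def by measurable
    have "{\<omega> \<in> space M. \<forall>k\<le>n. \<omega> k = x k} \<in> sets M"
      by measurable
    then have "measure M {\<omega>. \<forall>k\<le>n. \<omega> k = x k} = measure N {u. \<forall>k\<le>n. walk P u k = x k}"
      unfolding M_def by (subst measure_distr) (auto simp: space_PiM sets_M[unfolded M_def] vimage_def)
    also have "{u. \<forall>k\<le>n. walk P u k = x k} = (if x 0 = 0 then {u \<in> space N. \<forall>k\<in>{..<n}. u k \<in> A k} else {})"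
    proof -
      have "(\<forall>k\<le>n. walk P u k = x k) \<longleftrightarrow> x 0 = 0 \<and> (\<forall>k<n. u k \<in> A k)" for u
      proof (induction n)
        case (Suc n)
        have "(\<forall>k\<le>Suc n. walk P u k = x k) \<longleftrightarrow> (\<forall>k\<le>n. walk P u k = x k) \<and> walk P u (Suc n) = x (Suc n)"
          by (auto simp: le_Suc_eq)
        also have "\<dots> \<longleftrightarrow> (\<forall>k\<le>n. walk P u k = x k) \<and> u n \<in> A n"
          by (rule conj_cong[OF refl]) (simp add: A_def)
        finally show ?case
          using Suc by (auto simp: less_Suc_eq)
      qed auto
      then show ?thesis by auto
    qed
    also have "measure N \<dots> = of_bool (x 0 = 0) * (\<Prod>k<n. measure U (A k))"
    proof -
      have "emeasure N {u \<in> space N. \<forall>k\<in>{..<n}. u k \<in> A k} = (\<Prod>k<n. emeasure U (A k))"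
        unfolding N_def using A by (intro N.emeasure_PiM_Collect) auto
      also have "\<dots> = ennreal (\<Prod>k<n. measure U (A k))"
        by (simp add: U.emeasure_eq_measure prod_ennreal)
      finally have "measure N {u \<in> space N. \<forall>k\<in>{..<n}. u k \<in> A k} = (\<Prod>k<n. measure U (A k))"
        by (intro measure_eq_emeasure_eq_ennreal prod_nonneg) simp_all
      then show ?thesis by simp
    qed
    finally show ?thesis
      by (simp add: A_def step)
  qed
  have "markov_chain M K (\<lambda>n \<omega>. \<omega> n)"
    unfolding markov_chain_def
  proof (intro conjI allI impI)
    show "prob_space M"
      unfolding M_def by (rule prob_space.prob_space_distr[OF _ walk]) (simp add: N_def N.prob_space_axioms)
    show "(\<lambda>\<omega>. \<omega> n) \<in> measurable M (count_space UNIV)" for n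
      by measurable
    fix n and x :: "nat \<Rightarrow> int"
    assume pos: "0 < measure M {\<omega> \<in> space M. \<forall>k\<le>n. \<omega> k = x k}"
    have "{\<omega>. \<omega> (Suc n) = x (Suc n) \<and> (\<forall>k\<le>n. \<omega> k = x k)} = {\<omega>. \<forall>k\<le>Suc n. \<omega> k = x k}"
      by (auto simp: le_Suc_eq)
    moreover have "measure M {\<omega>. \<forall>k\<le>Suc n. \<omega> k = x k} =
        measure M {\<omega>. \<forall>k\<le>n. \<omega> k = x k} * K (x n) (x (Suc n))"
      by (simp add: path)
    ultimately show "\<P>(\<omega> in M. \<omega> (Suc n) = x (Suc n) \<bar> \<forall>k\<le>n. \<omega> k = x k) = K (x n) (x (Suc n))"
      using pos by (simp add: cond_prob_def)
  qed
  then show ?thesis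
    using that unfolding K_def by blast
qed

text \<open>The law of large numbers shows that \<open>v\<close> qualifies; the chain constructed
  above and the uniqueness of limits exclude every other value.\<close>

lemma velocity_eqI:
  assumes p: "\<And>i. 0 \<le> cyc m p i" "\<And>i. cyc m p i \<le> 1"
    and h: "\<And>x. \<bar>h x\<bar> \<le> B"
    and poisson: "\<And>x. cyc m p x * (1 + h (x + 1) - h x)
      + (1 - cyc m p x) * (-1 + h (x - 1) - h x) = v"
  shows "velocity m p = v"
proof -
  let ?P = "cyc m p"
  have trans: "cbd_trans m p = (\<lambda>i j. if j = i + 1 then ?P i else if j = i - 1 then 1 - ?P i else 0)"
    by (simp add: cbd_trans_def cyc_def fun_eq_iff)
  have lln: "AE \<omega> in M. (\<lambda>n. real_of_int (X n \<omega>) / real n) \<longlonglongrightarrow> v"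
    if "markov_chain M (cbd_trans m p) X" for M :: "(nat \<Rightarrow> int) measure" and X
  proof -
    interpret nearest_neighbour_chain M X ?P
      using that p by unfold_locales (auto simp: trans)
    show ?thesis
      using h poisson by (rule AE_velocity)
  qed
  obtain M :: "(nat \<Rightarrow> int) measure" and X where MX: "markov_chain M (cbd_trans m p) X"
    using nearest_neighbour_chain_exists[of ?P] p unfolding trans by blast
  interpret prob_space M
    using MX by (simp add: markov_chain_def)
  show ?thesis
    unfolding velocity_def
  proof (rule the_equality)
    fix w
    assume "\<forall>(M :: (nat \<Rightarrow> int) measure) X. markov_chain M (cbd_trans m p) X \<longrightarrow>
        (AE \<omega> in M. (\<lambda>n. real_of_int (X n \<omega>) / real n) \<longlonglongrightarrow> w)"
    with MX have "AE \<omega> in M. (\<lambda>n. real_of_int (X n \<omega>) / real n) \<longlonglongrightarrow> w"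
      by blast
    \<comment> \<open>The event \<open>w = v\<close> does not depend on \<open>\<omega>\<close>, so
      it holds outright once it holds almost everywhere in a probability space.\<close>
    with lln[OF MX] have "AE \<omega> in M. w = v"
      by eventually_elim (rule LIMSEQ_unique)
    then show "w = v" by simp
  qed (use lln in blast)
qed

section \<open>Zero sets of multiaffine polynomials\<close>

text \<open>Tonelli: a measurable set almost all of whose slices in direction \<open>j\<close> are
  null is null.\<close>

lemma AE_PiM_insertI:
  assumes I: "finite I" "j \<notin> I"
    and meas: "Measurable.pred (PiM (insert j I) (\<lambda>_. lborel :: real measure)) Q"
    and AE: "AE x in PiM I (\<lambda>_. lborel). AE t in lborel. Q (x(j := t))"
  shows "AE x in PiM (insert j I) (\<lambda>_. lborel :: real measure). Q x"
proof -
  interpret product_sigma_finite "\<lambda>_. lborel :: real measure"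
    by unfold_locales
  let ?M = "PiM (insert j I) (\<lambda>_. lborel :: real measure)"
  define N where "N = {x \<in> space ?M. \<not> Q x}"
  have N [measurable]: "N \<in> sets ?M"
    unfolding N_def using meas by measurable
  have "emeasure ?M N = (\<integral>\<^sup>+x. indicator N x \<partial>?M)"
    by simp
  also have "\<dots> = (\<integral>\<^sup>+x. (\<integral>\<^sup>+t. indicator N (x(j := t)) \<partial>lborel) \<partial>PiM I (\<lambda>_. lborel))"
    by (rule product_nn_integral_insert[OF I]) simp
  also have "\<dots> = (\<integral>\<^sup>+x. 0 \<partial>PiM I (\<lambda>_. lborel :: real measure))"
  proof (rule nn_integral_cong_AE)
    show "AE x in PiM I (\<lambda>_. lborel). (\<integral>\<^sup>+t. indicator N (x(j := t)) \<partial>lborel) = 0"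
      using AE
    proof eventually_elim
      case (elim x)
      have "(\<integral>\<^sup>+t. indicator N (x(j := t)) \<partial>lborel) = (\<integral>\<^sup>+(t::real). 0 \<partial>lborel)"
        using elim by (intro nn_integral_cong_AE) (auto simp: N_def)
      then show ?case by simp
    qed
  qed
  finally have "N \<in> null_sets ?M"
    using N by auto
  then show ?thesis
    by (rule AE_I') (auto simp: N_def)
qed

text \<open>
  Multiaffine polynomials in the basis that is dual to evaluation at the vertices of the cube,
  so that such a polynomial vanishes identically only if all coefficients \<open>c A\<close> vanish.
\<close>

definition subset_poly :: "nat set \<Rightarrow> (nat set \<Rightarrow> real) \<Rightarrow> (nat \<Rightarrow> real) \<Rightarrow> real" where
  "subset_poly I c p = (\<Sum>A\<in>Pow I. c A * ((\<Prod>i\<in>A. 1 - p i) * (\<Prod>i\<in>I - A. p i)))"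

text \<open>Affine interpolation in the variable \<open>t\<close>: index sets containing
  \<open>j\<close> carry the factor \<open>1 - t\<close> and give the value at \<open>t = 0\<close>,
  the others give the value at \<open>t = 1\<close>.\<close>

lemma subset_poly_insert:
  assumes "finite I" "j \<notin> I"
  shows "subset_poly (insert j I) c (p(j := t)) =
    (1 - t) * subset_poly I (\<lambda>A. c (insert j A)) p + t * subset_poly I c p"
proof -
  let ?p = "p(j := t)"
  let ?w = "\<lambda>I A. (\<Prod>i\<in>A. 1 - p i) * (\<Prod>i\<in>I - A. p i)"
  let ?w' = "\<lambda>A. (\<Prod>i\<in>A. 1 - ?p i) * (\<Prod>i\<in>insert j I - A. ?p i)"
  have eq: "(\<Prod>i\<in>A. 1 - ?p i) = (\<Prod>i\<in>A. 1 - p i)" "(\<Prod>i\<in>A. ?p i) = (\<Prod>i\<in>A. p i)" if "A \<subseteq> I" for A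
    using that assms by (auto intro!: prod.cong)
  have out: "?w' A = t * ?w I A" if "A \<subseteq> I" for A
  proof -
    have "insert j I - A = insert j (I - A)" using that assms by auto
    then show ?thesis
      using that assms by (simp add: eq finite_subset[OF _ assms(1)] del: fun_upd_apply) (simp add: eq)
  qed
  have ins: "?w' (insert j A) = (1 - t) * ?w I A" if "A \<subseteq> I" for A
  proof -
    have "insert j I - insert j A = I - A" "j \<notin> A" "finite A"
      using that assms finite_subset by auto
    then show ?thesis
      using that assms by (simp add: eq del: fun_upd_apply) (simp add: eq)
  qed
  have "subset_poly (insert j I) c ?p = (\<Sum>A\<in>Pow I \<union> insert j ` Pow I. c A * ?w' A)"
    by (simp add: subset_poly_def Pow_insert)
  also have "\<dots> = (\<Sum>A\<in>Pow I. c A * ?w' A) + (\<Sum>A\<in>insert j ` Pow I. c A * ?w' A)"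
    using assms by (intro sum.union_disjoint) auto
  also have "(\<Sum>A\<in>insert j ` Pow I. c A * ?w' A) = (\<Sum>A\<in>Pow I. c (insert j A) * ?w' (insert j A))"
  proof -
    have "inj_on (insert j) (Pow I)"
      using assms(2) by (intro inj_onI) (metis PowD insert_ident subset_iff)
    then show ?thesis
      by (subst sum.reindex) (simp_all add: o_def)
  qed
  also have "\<dots> = (1 - t) * subset_poly I (\<lambda>A. c (insert j A)) p"
    unfolding subset_poly_def sum_distrib_left by (intro sum.cong refl) (subst ins, auto)
  also have "(\<Sum>A\<in>Pow I. c A * ?w' A) = t * subset_poly I c p"
    unfolding subset_poly_def sum_distrib_left by (intro sum.cong refl) (subst out, auto)
  finally show ?thesis by (simp only: add.commute)
qed

lemma subset_poly_measurable:
  "finite I \<Longrightarrow> subset_poly I c \<in> borel_measurable (PiM I (\<lambda>_. lborel))"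
  unfolding subset_poly_def[abs_def]
  by (intro borel_measurable_sum borel_measurable_times borel_measurable_prod borel_measurable_diff borel_measurable_const
      measurable_component_singleton[where M = "\<lambda>_. lborel", THEN measurable_compose[where N = lborel], of _ _ "\<lambda>x. x", simplified])
     auto

text \<open>Induction on the variables. The nonzero coefficient survives in one of the two endpoint
  polynomials, which is almost everywhere nonzero by induction; where it is, the polynomial is
  affine in \<open>t\<close> and not identically zero, so it has at most one root.\<close>

lemma AE_subset_poly_nonzero:
  assumes "finite I" and "A \<subseteq> I" and "c A \<noteq> 0"
  shows "AE p in PiM I (\<lambda>_. lborel). subset_poly I c p \<noteq> 0"
  using assms
proof (induction I arbitrary: A c rule: finite_induct)
  case empty
  then show ?case by (simp add: subset_poly_def)
next
  case (insert j I)
  let ?c = "\<lambda>A. c (insert j A)"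
  have "AE p in PiM I (\<lambda>_. lborel). subset_poly I ?c p \<noteq> 0 \<or> subset_poly I c p \<noteq> 0"
  proof (cases "j \<in> A")
    case True
    then have "insert j (A - {j}) = A" by auto
    then have "AE p in PiM I (\<lambda>_. lborel). subset_poly I ?c p \<noteq> 0"
      using insert.prems by (intro insert.IH[of "A - {j}"]) auto
    then show ?thesis by eventually_elim simp
  next
    case False
    then have "AE p in PiM I (\<lambda>_. lborel). subset_poly I c p \<noteq> 0"
      using insert.prems by (intro insert.IH[of A]) auto
    then show ?thesis by eventually_elim simp
  qed
  then have "AE p in PiM I (\<lambda>_. lborel). AE t in lborel. subset_poly (insert j I) c (p(j := t)) \<noteq> 0"
  proof eventually_elim
    case (elim p)
    define a b where "a = subset_poly I c p" and "b = subset_poly I ?c p"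
    \<comment> \<open>The only root in \<open>t\<close> if \<open>a\<close> and \<open>b\<close>
      differ; if they agree, the polynomial is constant in \<open>t\<close> and nonzero.\<close>
    have "AE t in lborel. t \<noteq> b / (b - a)"
      by (rule AE_lborel_singleton)
    then show ?case
    proof eventually_elim
      case (elim t)
      show ?case
      proof
        assume "subset_poly (insert j I) c (p(j := t)) = 0"
        then have *: "(1 - t) * b + t * a = 0"
          using insert.hyps by (simp add: subset_poly_insert a_def b_def)
        show False
        proof (cases "a = b")
          case True
          with * have "b = 0" by (simp add: algebra_simps)
          with True \<open>subset_poly I ?c p \<noteq> 0 \<or> subset_poly I c p \<noteq> 0\<close> show False
            by (simp add: a_def b_def)
        next
          case False
          then have "t = b / (b - a)"
            using * by (simp add: field_simps)
          with elim show False by simp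
        qed
      qed
    qed
  qed
  moreover have [measurable]: "subset_poly (insert j I) c \<in> borel_measurable (PiM (insert j I) (\<lambda>_. lborel))"
    using insert.hyps by (intro subset_poly_measurable) simp
  ultimately show ?case
    by (intro AE_PiM_insertI insert.hyps(1,2)) measurable
qed

section \<open>Cyclic arcs and dihedral classes\<close>

definition cyc_arc :: "nat \<Rightarrow> nat \<Rightarrow> nat \<Rightarrow> nat set" where
  "cyc_arc m i k = (\<lambda>j. (i + j) mod m) ` {..<k}"

text \<open>The number of arcs mapped onto \<open>A\<close> by \<open>\<tau>\<close>, with lengths
  counted as in \<open>arc_total\<close>. These are the coefficients of the denominator of the
  velocity once it is multiplied by all parameters.\<close>

definition arc_coeff :: "nat \<Rightarrow> (nat \<Rightarrow> nat) \<Rightarrow> nat set \<Rightarrow> real" where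
  "arc_coeff m \<tau> A =
     (\<Sum>k<m. \<Sum>i<m. of_bool (\<tau> ` cyc_arc m i k = A) + of_bool (\<tau> ` cyc_arc m i (Suc k) = A))"

lemma cyc_arc_inj_on:
  fixes i k m :: nat
  assumes "k \<le> m"
  shows "inj_on (\<lambda>j. (i + j) mod m) {..<k}"
proof (rule inj_onI)
  fix a b assume ab: "a \<in> {..<k}" "b \<in> {..<k}" and "(i + a) mod m = (i + b) mod m"
  then have "a mod m = b mod m"
    using cong_add_lcancel_nat[of i a b m] by (simp add: cong_def)
  with ab assms show "a = b" by simp
qed

lemma card_cyc_arc: "k \<le> m \<Longrightarrow> card (cyc_arc m i k) = k"
  by (simp add: cyc_arc_def card_image cyc_arc_inj_on)

lemma cyc_arc_subset: "m > 0 \<Longrightarrow> cyc_arc m i k \<subseteq> {..<m}"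
  by (auto simp: cyc_arc_def)

lemma cyc_arc_2: "i < m \<Longrightarrow> cyc_arc m i 2 = {i, Suc i mod m}"
  by (auto simp: cyc_arc_def numeral_2_eq_2 lessThan_Suc)

text \<open>Multiplying by all \<open>p i\<close> clears denominators: a product of odds over a set
  \<open>B\<close> becomes \<open>1 - p\<close> on \<open>B\<close> times \<open>p\<close> on the
  complement, the basis element of \<open>B\<close>.\<close>

lemma subset_poly_arc_coeff:
  assumes m: "m > 0" and \<tau>: "\<tau> permutes {..<m}" and p: "\<And>i. i < m \<Longrightarrow> p i \<in> {0<..<1}"
  shows "subset_poly {..<m} (arc_coeff m \<tau>) p = arc_total m (p \<circ> \<tau>) * (\<Prod>i<m. p i)"
proof -
  let ?w = "\<lambda>A. (\<Prod>i\<in>A. 1 - p i) * (\<Prod>i\<in>{..<m} - A. p i)"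
  have sub: "\<tau> ` cyc_arc m i k \<subseteq> {..<m}" for i k
    using cyc_arc_subset[OF m] permutes_image[OF \<tau>] by blast
  have arc: "(\<Prod>j<k. odds (cyc m (p \<circ> \<tau>) (int i + int j))) * (\<Prod>i<m. p i) = ?w (\<tau> ` cyc_arc m i k)"
    if k: "k \<le> m" for i k
  proof -
    let ?B = "\<tau> ` cyc_arc m i k"
    have "cyc m (p \<circ> \<tau>) (int i + int j) = p (\<tau> ((i + j) mod m))" for j
      by (simp add: cyc_def flip: of_nat_add of_nat_mod)
    moreover have "inj_on (\<lambda>j. \<tau> ((i + j) mod m)) {..<k}"
      using comp_inj_on[OF cyc_arc_inj_on[OF k, of i] inj_on_subset[OF permutes_inj[OF \<tau>]]]
      by (simp add: o_def)
    moreover have "?B = (\<lambda>j. \<tau> ((i + j) mod m)) ` {..<k}"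
      by (auto simp: cyc_arc_def)
    ultimately have "(\<Prod>j<k. odds (cyc m (p \<circ> \<tau>) (int i + int j))) = (\<Prod>l\<in>?B. odds (p l))"
      by (simp add: prod.reindex)
    moreover have "(\<Prod>i<m. p i) = (\<Prod>l\<in>?B. p l) * (\<Prod>l\<in>{..<m} - ?B. p l)"
      using prod.subset_diff[OF sub, of p] by (simp add: mult.commute)
    moreover have "(\<Prod>l\<in>?B. odds (p l)) * (\<Prod>l\<in>?B. p l) = (\<Prod>l\<in>?B. 1 - p l)"
      unfolding prod.distrib[symmetric]
    proof (rule prod.cong[OF refl])
      fix l assume "l \<in> ?B"
      then have "l < m" using sub by blast
      then show "odds (p l) * p l = 1 - p l" using p[of l] by (simp add: odds_def)
    qed
    ultimately show ?thesis by (simp only: mult.assoc[symmetric])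
  qed
  have pick: "(\<Sum>A\<in>Pow {..<m}. of_bool (\<tau> ` cyc_arc m i k = A) * ?w A) = ?w (\<tau> ` cyc_arc m i k)" for i k
    using sub[of i k] by (simp add: of_bool_def if_distrib[where f = "\<lambda>x. x * _"] cong: if_cong)
  have "subset_poly {..<m} (arc_coeff m \<tau>) p =
      (\<Sum>A\<in>Pow {..<m}. \<Sum>k<m. \<Sum>i<m. of_bool (\<tau> ` cyc_arc m i k = A) * ?w A + of_bool (\<tau> ` cyc_arc m i (Suc k) = A) * ?w A)"
    by (simp only: subset_poly_def arc_coeff_def sum_distrib_right distrib_right)
  also have "\<dots> = (\<Sum>k<m. \<Sum>i<m. \<Sum>A\<in>Pow {..<m}. of_bool (\<tau> ` cyc_arc m i k = A) * ?w A + of_bool (\<tau> ` cyc_arc m i (Suc k) = A) * ?w A)"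
    by (subst sum.swap, rule sum.cong[OF refl], rule sum.swap)
  also have "\<dots> = (\<Sum>k<m. \<Sum>i<m. ?w (\<tau> ` cyc_arc m i k) + ?w (\<tau> ` cyc_arc m i (Suc k)))"
    by (simp only: sum.distrib pick)
  also have "\<dots> = (\<Sum>k<m. \<Sum>i<m. (\<Prod>j<k. odds (cyc m (p \<circ> \<tau>) (int i + int j))) * (\<Prod>i<m. p i)
      + (\<Prod>j<Suc k. odds (cyc m (p \<circ> \<tau>) (int i + int j))) * (\<Prod>i<m. p i))"
    by (intro sum.cong refl arg_cong2[where f = "(+)"] arc[symmetric]) auto
  also have "\<dots> = arc_total m (p \<circ> \<tau>) * (\<Prod>i<m. p i)"
    by (simp only: arc_total_def arc_sum_def sum.distrib sum_distrib_right distrib_right)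
  finally show ?thesis .
qed

lemma arc_coeff_nonzeroD:
  assumes "arc_coeff m \<tau> A \<noteq> 0"
  obtains i k where "i < m" and "k \<le> m" and "\<tau> ` cyc_arc m i k = A"
proof -
  have "\<exists>k<m. \<exists>i<m. \<tau> ` cyc_arc m i k = A \<or> \<tau> ` cyc_arc m i (Suc k) = A"
  proof (rule ccontr)
    assume "\<not> ?thesis"
    then have "arc_coeff m \<tau> A = 0"
      unfolding arc_coeff_def by (intro sum.neutral ballI) auto
    with assms show False by simp
  qed
  then show ?thesis
    using that by (metis Suc_leI less_imp_le)
qed

lemma arc_coeff_nonzeroI:
  assumes "i < m" and "0 < k" and "k \<le> m"
  shows "arc_coeff m \<tau> (\<tau> ` cyc_arc m i k) \<noteq> 0"
proof -
  let ?f = "\<lambda>k' i'. of_bool (\<tau> ` cyc_arc m i' k' = \<tau> ` cyc_arc m i k) +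
    of_bool (\<tau> ` cyc_arc m i' (Suc k') = \<tau> ` cyc_arc m i k) :: real"
  \<comment> \<open>Length \<open>k\<close> appears as \<open>Suc (k - 1)\<close>, which also
    reaches \<open>k = m\<close>; all terms are nonnegative, so nothing cancels.\<close>
  have "0 < ?f (k - 1) i"
    using assms(2) by simp
  also have "\<dots> \<le> (\<Sum>i'<m. ?f (k - 1) i')"
    using assms(1) by (intro member_le_sum) auto
  also have "\<dots> \<le> (\<Sum>k'<m. \<Sum>i'<m. ?f k' i')"
    using assms by (intro member_le_sum[of "k - 1" _ "\<lambda>k'. \<Sum>i'<m. ?f k' i'"]) (auto intro!: sum_nonneg)
  finally show ?thesis
    by (simp add: arc_coeff_def)
qed

text \<open>Mapping edges of the cycle to edges forces each step of \<open>\<pi>\<close> to be 1 or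
  -1 modulo \<open>m\<close>. A change of direction would send two vertices at distance two to the
  same place, which injectivity forbids for \<open>m \<ge> 3\<close>.\<close>

lemma adjacency_preserving_dihedral:
  assumes m: "m \<ge> 3" and \<pi>: "\<pi> permutes {..<m}"
    and adj: "\<And>i. i < m \<Longrightarrow> \<exists>j<m. \<pi> ` cyc_arc m i 2 = cyc_arc m j 2"
  obtains s a where "\<bar>s\<bar> = 1" and "0 \<le> a" and "a < int m" and "\<pi> = dihedral m s a"
proof -
  \<comment> \<open>Reading \<open>\<pi>\<close> periodically along all natural numbers removes the
    special case of the edge from \<open>m - 1\<close> to \<open>0\<close>.\<close>
  define w where "w j = int (\<pi> (j mod m))" for j
  have \<pi>_less: "\<pi> i < m" if "i < m" for i
    using permutes_in_image[OF \<pi>, of i] that by simp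
  have w_eqD: "i mod m = j mod m" if "[w i = w j] (mod int m)" for i j
  proof -
    have "\<pi> (i mod m) = \<pi> (j mod m)"
      using that m \<pi>_less by (simp add: w_def cong_def)
    then show ?thesis
      using permutes_inj[OF \<pi>] by (simp add: inj_eq)
  qed
  have step: "\<exists>s. \<bar>s\<bar> = 1 \<and> [w (Suc j) = w j + s] (mod int m)" for j
  proof -
    obtain i where i: "i < m" and "\<pi> ` cyc_arc m (j mod m) 2 = cyc_arc m i 2"
      using adj[of "j mod m"] m by auto
    then have "{\<pi> (j mod m), \<pi> (Suc j mod m)} = {i, Suc i mod m}"
      using m by (simp add: cyc_arc_2 mod_Suc_eq)
    then consider "\<pi> (j mod m) = i" "\<pi> (Suc j mod m) = Suc i mod m"
      | "\<pi> (j mod m) = Suc i mod m" "\<pi> (Suc j mod m) = i"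
      by (auto simp: doubleton_eq_iff)
    then show ?thesis
    proof cases
      case 1
      then have "[w (Suc j) = w j + 1] (mod int m)"
        by (simp add: w_def cong_def zmod_int mod_simps add.commute)
      then show ?thesis by (intro exI[of _ 1]) simp
    next
      case 2
      then have "[w (Suc j) = w j + (-1)] (mod int m)"
        by (simp add: w_def cong_def zmod_int mod_simps)
      then show ?thesis by (intro exI[of _ "-1"]) simp
    qed
  qed
  obtain s where s: "\<bar>s\<bar> = 1" "[w (Suc 0) = w 0 + s] (mod int m)"
    using step by blast
  \<comment> \<open>Two consecutive positions are carried along, since ruling out a reversal
    compares the next position with the one before the current.\<close>
  have walk: "[w j = w 0 + s * int j] (mod int m) \<and> [w (Suc j) = w 0 + s * int (Suc j)] (mod int m)" for j
  proof (induction j)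
    case 0
    then show ?case using s by simp
  next
    case (Suc j)
    obtain s' where s': "\<bar>s'\<bar> = 1" "[w (Suc (Suc j)) = w (Suc j) + s'] (mod int m)"
      using step by blast
    have "s' = s"
    proof (rule ccontr)
      assume "s' \<noteq> s"
      then have "s' = - s" using s(1) s'(1) by arith
      have "[w (Suc j) + s' = w 0 + s * int (Suc j) + s'] (mod int m)"
        using Suc by (intro cong_add) auto
      also have "w 0 + s * int (Suc j) + s' = w 0 + s * int j"
        using \<open>s' = - s\<close> by (simp add: algebra_simps)
      finally have "[w (Suc (Suc j)) = w j] (mod int m)"
        using s'(2) Suc by (meson cong_sym cong_trans)
      from w_eqD[OF this] have "[j + 2 = j + 0] (mod m)"
        by (simp add: cong_def)
      then have "[2 = 0] (mod m)"
        by (simp only: cong_add_lcancel_nat)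
      then show False using m by (simp add: cong_def)
    qed
    have "[w (Suc j) + s' = w 0 + s * int (Suc j) + s'] (mod int m)"
      using Suc by (intro cong_add) auto
    with s'(2) have "[w (Suc (Suc j)) = w 0 + s * int (Suc j) + s'] (mod int m)"
      by (rule cong_trans)
    then have "[w (Suc (Suc j)) = w 0 + s * int (Suc (Suc j))] (mod int m)"
      using \<open>s' = s\<close> by (simp add: algebra_simps)
    with Suc show ?case by blast
  qed
  have "\<pi> i = dihedral m s (w 0) i" for i
  proof (cases "i < m")
    case True
    then have "int (\<pi> i) mod int m = (w 0 + s * int i) mod int m"
      using walk[of i] by (simp add: w_def cong_def)
    then show ?thesis
      using True \<pi>_less[OF True] by (simp add: dihedral_def)
  next
    case False
    then show ?thesis
      using \<pi> by (simp add: dihedral_def permutes_not_in)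
  qed
  then have "\<pi> = dihedral m s (w 0)" by auto
  moreover have "0 \<le> w 0" "w 0 < int m"
    using m \<pi>_less by (simp_all add: w_def)
  ultimately show ?thesis
    using that s(1) by blast
qed

definition dihedrals :: "nat \<Rightarrow> (nat \<Rightarrow> nat) set" where
  "dihedrals m = (\<lambda>(s, a). dihedral m s a) ` ({1, -1} \<times> {0..<int m})"

text \<open>The value at 0 recovers \<open>a\<close> and the value at 1 then recovers
  \<open>s\<close>, since 1 and -1 differ modulo \<open>m \<ge> 3\<close>.\<close>

lemma card_dihedrals:
  assumes m: "m \<ge> 3"
  shows "card (dihedrals m) = 2 * m"
proof -
  have "inj_on (\<lambda>(s, a). dihedral m s a) ({1, -1} \<times> {0..<int m})"
  proof (rule inj_onI, clarify)
    fix s a s' a' :: int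
    assume s: "s \<in> {1, -1}" "s' \<in> {1, -1}" and a: "a \<in> {0..<int m}" "a' \<in> {0..<int m}"
      and eq: "dihedral m s a = dihedral m s' a'"
    have "a = a'"
      using fun_cong[OF eq, of 0] m a by (auto simp: dihedral_def eq_nat_nat_iff)
    moreover have "(a + s) mod int m = (a' + s') mod int m"
      using fun_cong[OF eq, of 1] m by (simp add: dihedral_def nat_eq_iff2)
    ultimately have "int m dvd s - s'"
      by (simp add: mod_eq_dvd_iff)
    then have "s = s'"
      using s m dvd_imp_le_int[of "s - s'" "int m"] by auto
    with \<open>a = a'\<close> show "s = s' \<and> a = a'" by simp
  qed
  then show ?thesis
    by (simp add: dihedrals_def card_image card_cartesian_product)
qed

text \<open>The image of an edge under \<open>\<sigma>\<close> has a nonzero coefficient, so it is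
  also the image of an arc under \<open>\<tau>\<close>, and by cardinality that arc is an edge. Thus
  \<open>inv \<tau> \<circ> \<sigma>\<close> maps edges to edges.\<close>

lemma arc_coeff_eq_imp_dihedral:
  assumes m: "m \<ge> 3" and \<tau>: "\<tau> permutes {..<m}" and \<sigma>: "\<sigma> permutes {..<m}"
    and eq: "\<And>A. A \<subseteq> {..<m} \<Longrightarrow> arc_coeff m \<tau> A = arc_coeff m \<sigma> A"
  shows "\<sigma> \<in> (\<lambda>\<delta>. \<tau> \<circ> \<delta>) ` dihedrals m"
proof -
  define \<pi> where "\<pi> = inv \<tau> \<circ> \<sigma>"
  have \<pi>: "\<pi> permutes {..<m}"
    unfolding \<pi>_def by (rule permutes_compose[OF \<sigma> permutes_inv[OF \<tau>]])
  have "\<exists>j<m. \<pi> ` cyc_arc m i 2 = cyc_arc m j 2" if i: "i < m" for i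
  proof -
    let ?A = "\<sigma> ` cyc_arc m i 2"
    have "?A \<subseteq> {..<m}"
      using cyc_arc_subset[of m i 2] permutes_image[OF \<sigma>] m by auto
    then have "arc_coeff m \<tau> ?A \<noteq> 0"
      using arc_coeff_nonzeroI[OF i, of 2 \<sigma>] m eq by simp
    then obtain j k where jk: "j < m" "k \<le> m" "\<tau> ` cyc_arc m j k = ?A"
      by (rule arc_coeff_nonzeroD)
    have inj: "inj_on \<tau> S" "inj_on \<sigma> S" for S
      using permutes_inj[OF \<tau>] permutes_inj[OF \<sigma>] inj_on_subset by blast+
    have "card (\<tau> ` cyc_arc m j k) = k" "card ?A = 2"
      using m jk(2) by (simp_all add: card_image inj card_cyc_arc)
    with jk(3) have "k = 2" by simp
    have "\<pi> ` cyc_arc m i 2 = inv \<tau> ` ?A"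
      by (simp add: \<pi>_def image_comp)
    also have "\<dots> = cyc_arc m j k"
      using permutes_inj[OF \<tau>] by (simp flip: jk(3) add: image_inv_f_f)
    finally show ?thesis using jk(1) \<open>k = 2\<close> by blast
  qed
  then obtain s a where "\<bar>s\<bar> = 1" "0 \<le> a" "a < int m" "\<pi> = dihedral m s a"
    using adjacency_preserving_dihedral[OF m \<pi>] by blast
  then have "\<pi> \<in> dihedrals m"
    unfolding dihedrals_def by (intro image_eqI[of _ _ "(s, a)"]) (auto simp: abs_if split: if_splits)
  moreover have "\<sigma> = \<tau> \<circ> \<pi>"
    using permutes_inverses(1)[OF \<tau>] by (simp add: \<pi>_def fun_eq_iff)
  ultimately show ?thesis by blast
qed

section \<open>Velocities of permuted parameters and their fibres\<close>

lemma velocity_eq: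
  assumes m: "m > 0" and p: "\<And>i. i < m \<Longrightarrow> p i \<in> {0<..<1}"
  shows "velocity m p = cbd_velocity m p"
proof -
  have "0 \<le> cyc m p i" "cyc m p i \<le> 1" for i
    using cyc_mem[OF m p, where x = i] by (auto simp: less_imp_le)
  moreover obtain h B where "\<And>x. \<bar>h x\<bar> \<le> B"
    "\<And>x. cyc m p x * (1 + h (x + 1) - h x) + (1 - cyc m p x) * (-1 + h (x - 1) - h x) = cbd_velocity m p"
    by (rule cbd_poisson_equation[of m p, OF m p]) blast+
  ultimately show ?thesis
    by (intro velocity_eqI[of m p h B])
qed

lemma velocity_permuted:
  assumes m: "m > 0" and p: "\<And>i. i < m \<Longrightarrow> p i \<in> {0<..<1}" and \<tau>: "\<tau> permutes {..<m}"
  shows "velocity m (p \<circ> \<tau>) = real m * (1 - (\<Prod>i<m. odds (p i))) / arc_total m (p \<circ> \<tau>)"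
proof -
  have "(p \<circ> \<tau>) i \<in> {0<..<1}" if "i < m" for i
    using p[of "\<tau> i"] permutes_in_image[OF \<tau>, of i] that by simp
  then have "velocity m (p \<circ> \<tau>) = cbd_velocity m (p \<circ> \<tau>)"
    by (rule velocity_eq[OF m])
  moreover have "(\<Prod>i<m. odds ((p \<circ> \<tau>) i)) = (\<Prod>i<m. odds (p i))"
    using prod.permute[OF \<tau>, of "\<lambda>i. odds (p i)"] by (simp add: o_def)
  ultimately show ?thesis
    by (simp add: cbd_velocity_def)
qed

text \<open>For each of the finitely many pairs in different classes, the difference of the two arc
  polynomials has a nonzero coefficient and so vanishes only on a null set. Elsewhere, if
  \<open>R \<noteq> 1\<close> for the product \<open>R\<close> of all odds, equal velocities mean
  equal denominators, which puts the pair in one class.\<close>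

lemma AE_velocity_determines_dihedral_class:
  assumes m: "m \<ge> 3"
  shows "AE p in PiM {..<m} (\<lambda>_. lborel). (\<forall>i<m. p i \<in> {0<..<1}) \<longrightarrow>
    (\<forall>\<tau> \<sigma>. \<tau> permutes {..<m} \<longrightarrow> \<sigma> permutes {..<m} \<longrightarrow>
      velocity m (p \<circ> \<tau>) = velocity m (p \<circ> \<sigma>) \<longrightarrow> \<sigma> \<in> (\<lambda>\<delta>. \<tau> \<circ> \<delta>) ` dihedrals m)"
proof -
  let ?d = "\<lambda>\<tau> \<sigma> A. arc_coeff m \<tau> A - arc_coeff m \<sigma> A"
  define S where "S = {(\<tau>, \<sigma>). \<tau> permutes {..<m} \<and> \<sigma> permutes {..<m} \<and> \<sigma> \<notin> (\<lambda>\<delta>. \<tau> \<circ> \<delta>) ` dihedrals m}"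
  have "finite S"
    by (rule finite_subset[of _ "{\<tau>. \<tau> permutes {..<m}} \<times> {\<tau>. \<tau> permutes {..<m}}"])
       (auto simp: S_def finite_permutations)
  moreover have "AE p in PiM {..<m} (\<lambda>_. lborel). subset_poly {..<m} (?d \<tau> \<sigma>) p \<noteq> 0" if "(\<tau>, \<sigma>) \<in> S" for \<tau> \<sigma>
  proof -
    have "\<exists>A\<subseteq>{..<m}. arc_coeff m \<tau> A \<noteq> arc_coeff m \<sigma> A"
      using that arc_coeff_eq_imp_dihedral[OF m, of \<tau> \<sigma>] by (auto simp: S_def)
    then show ?thesis
      by (auto intro: AE_subset_poly_nonzero)
  qed
  ultimately have "AE p in PiM {..<m} (\<lambda>_. lborel). \<forall>(\<tau>, \<sigma>)\<in>S. subset_poly {..<m} (?d \<tau> \<sigma>) p \<noteq> 0"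
    by (intro AE_finite_allI) auto
  \<comment> \<open>This polynomial is the product of all \<open>1 - p i\<close> minus the product
    of all \<open>p i\<close>; its zeros in the open cube are the points with \<open>R = 1\<close>,
    where every velocity is 0.\<close>
  moreover have "AE p in PiM {..<m} (\<lambda>_. lborel).
      subset_poly {..<m} (\<lambda>A. of_bool (A = {..<m}) - of_bool (A = {})) p \<noteq> 0"
    using m by (intro AE_subset_poly_nonzero[where A = "{}"]) (use lessThan_eq_iff[of m 0] in auto)
  ultimately show ?thesis
  proof eventually_elim
    case (elim p)
    show ?case
    proof (intro impI allI)
      fix \<tau> \<sigma>
      assume "\<forall>i<m. p i \<in> {0<..<1}" and \<tau>: "\<tau> permutes {..<m}" and \<sigma>: "\<sigma> permutes {..<m}"
        and vel: "velocity m (p \<circ> \<tau>) = velocity m (p \<circ> \<sigma>)"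
      then have p: "p i \<in> {0<..<1}" if "i < m" for i using that by blast
      have m0: "m > 0" using m by simp
      have P: "(\<Prod>i<m. p i) > 0"
        using p by (intro prod_pos) auto
      have "(\<Prod>i<m. 1 - p i) = (\<Prod>i<m. odds (p i)) * (\<Prod>i<m. p i)"
        unfolding prod.distrib[symmetric] using p by (intro prod.cong refl) (force simp: odds_def)
      moreover have "(\<Prod>i<m. 1 - p i) \<noteq> (\<Prod>i<m. p i)"
      proof -
        have "subset_poly {..<m} (\<lambda>A. of_bool (A = {..<m}) - of_bool (A = {})) p =
            (\<Prod>i<m. 1 - p i) - (\<Prod>i<m. p i)"
          by (simp add: subset_poly_def left_diff_distrib sum_subtractf of_bool_def
              if_distrib[where f = "\<lambda>x. x * _"] cong: if_cong)
        with elim(2) show ?thesis by simp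
      qed
      ultimately have R: "(\<Prod>i<m. odds (p i)) \<noteq> 1" by auto
      have pos: "arc_total m (p \<circ> \<rho>) > 0" if "\<rho> permutes {..<m}" for \<rho>
        using m0 p permutes_in_image[OF that] by (intro arc_total_pos) auto
      from vel have "arc_total m (p \<circ> \<tau>) = arc_total m (p \<circ> \<sigma>)"
        using m0 R pos[OF \<tau>] pos[OF \<sigma>]
        by (simp add: velocity_permuted[OF m0 p] \<tau> \<sigma> frac_eq_eq)
      then have "subset_poly {..<m} (?d \<tau> \<sigma>) p = 0"
        using subset_poly_arc_coeff[OF m0 \<tau> p] subset_poly_arc_coeff[OF m0 \<sigma> p]
        by (simp add: subset_poly_def left_diff_distrib sum_subtractf)
      with elim(1) \<tau> \<sigma> show "\<sigma> \<in> (\<lambda>\<delta>. \<tau> \<circ> \<delta>) ` dihedrals m"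
        by (auto simp: S_def)
    qed
  qed
qed

text \<open>The numerator of the velocity is symmetric in all parameters, and the denominator is
  dihedrally invariant.\<close>

lemma dihedral_class_subset_fibre:
  assumes m: "m > 0" and p: "\<And>i. i < m \<Longrightarrow> p i \<in> {0<..<1}" and \<tau>: "\<tau> permutes {..<m}"
  shows "(\<lambda>\<delta>. \<tau> \<circ> \<delta>) ` dihedrals m \<subseteq>
    {\<sigma>. \<sigma> permutes {..<m} \<and> velocity m (p \<circ> \<sigma>) = velocity m (p \<circ> \<tau>)}"
proof clarify
  fix \<delta> assume "\<delta> \<in> dihedrals m"
  then obtain s a where \<delta>: "\<delta> = dihedral m s a" and s: "\<bar>s\<bar> = 1"
    by (auto simp: dihedrals_def)
  have perm: "\<tau> \<circ> \<delta> permutes {..<m}"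
    unfolding \<delta> by (rule permutes_compose[OF dihedral_permutes[OF m s] \<tau>])
  have "arc_total m (p \<circ> (\<tau> \<circ> \<delta>)) = arc_total m (p \<circ> \<tau>)"
    unfolding \<delta> comp_assoc[symmetric] by (simp add: arc_total_def arc_sum_dihedral[OF m s])
  then show "\<tau> \<circ> \<delta> permutes {..<m} \<and> velocity m (p \<circ> (\<tau> \<circ> \<delta>)) = velocity m (p \<circ> \<tau>)"
    using perm by (simp add: velocity_permuted[OF m p] \<tau>)
qed

lemma card_dihedral_class:
  assumes "m \<ge> 3" and "\<tau> permutes {..<m}"
  shows "card ((\<lambda>\<delta>. \<tau> \<circ> \<delta>) ` dihedrals m) = 2 * m"
proof -
  have "inj_on (\<lambda>\<delta>. \<tau> \<circ> \<delta>) (dihedrals m)"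
    using permutes_inj[OF assms(2)] by (intro inj_onI) (metis fun.inj_map injD)
  then show ?thesis
    by (simp add: card_image card_dihedrals assms(1))
qed

section \<open>Counting the velocities by the sizes of their fibres\<close>

lemma fact_eq_sum_card_fibres:
  "fact m = (\<Sum>v\<in>(\<lambda>\<tau>. velocity m (p \<circ> \<tau>)) ` {\<tau>. \<tau> permutes {..<m}}.
    card {\<sigma>. \<sigma> permutes {..<m} \<and> velocity m (p \<circ> \<sigma>) = v})"
proof -
  have "finite {\<tau>. \<tau> permutes {..<m}}"
    by (simp add: finite_permutations)
  from sum.image_gen[OF this, of "\<lambda>_. 1 :: nat" "\<lambda>\<tau>. velocity m (p \<circ> \<tau>)"]
  show ?thesis
    by (simp add: card_permutations)
qed

lemma num_velocities_eq_card:
  "num_velocities m p = card ((\<lambda>\<tau>. velocity m (p \<circ> \<tau>)) ` {\<tau>. \<tau> permutes {..<m}})"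
  unfolding num_velocities_def by (rule arg_cong[where f = card]) auto

theorem theorem1:
  fixes m :: nat
  assumes "m \<ge> 3"
  shows "(AE p in PiM {..<m} (\<lambda>_. lborel :: real measure).
            (\<forall>i<m. p i \<in> {0<..<1}) \<longrightarrow>
              real (num_velocities m p) = fact m / (2 * real m) \<and>
              real (num_velocities m p) = fact (m - 1) / 2)
       \<and> (\<forall>p :: nat \<Rightarrow> real. (\<forall>i<m. p i \<in> {0<..<1}) \<longrightarrow>
              real (num_velocities m p) \<le> fact (m - 1) / 2)"
proof
  have m0: "m > 0" using assms by simp
  have fact: "fact m = m * (fact (m - 1) :: nat)"
    using fact_reduce[OF m0, where 'a = nat] by simp
  let ?F = "\<lambda>p v. {\<sigma>. \<sigma> permutes {..<m} \<and> velocity m (p \<circ> \<sigma>) = v}"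
  show "\<forall>p :: nat \<Rightarrow> real. (\<forall>i<m. p i \<in> {0<..<1}) \<longrightarrow> real (num_velocities m p) \<le> fact (m - 1) / 2"
  proof (intro allI impI)
    fix p :: "nat \<Rightarrow> real" assume p: "\<forall>i<m. p i \<in> {0<..<1}"
    \<comment> \<open>Every fibre contains a full dihedral class, so the \<open>m!\<close>
      permutations form at most \<open>m! / (2 * m)\<close> fibres.\<close>
    have "2 * m \<le> card (?F p (velocity m (p \<circ> \<tau>)))" if "\<tau> permutes {..<m}" for \<tau>
      using card_mono[OF _ dihedral_class_subset_fibre[OF m0 _ that, of p]] p card_dihedral_class[OF assms that]
      by (simp add: finite_permutations)
    then have "2 * m * num_velocities m p \<le> fact m"
      unfolding fact_eq_sum_card_fibres[of m p] num_velocities_eq_card mult.commute[of "2 * m"]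
      by (intro sum_bounded_below[where 'a = nat, simplified]) auto
    then have "2 * num_velocities m p \<le> fact (m - 1)"
      using m0 by (simp add: fact)
    then have "real (2 * num_velocities m p) \<le> real (fact (m - 1))"
      by (simp only: of_nat_le_iff)
    then show "real (num_velocities m p) \<le> fact (m - 1) / 2"
      by simp
  qed
  show "AE p in PiM {..<m} (\<lambda>_. lborel :: real measure). (\<forall>i<m. p i \<in> {0<..<1}) \<longrightarrow>
      real (num_velocities m p) = fact m / (2 * real m) \<and> real (num_velocities m p) = fact (m - 1) / 2"
    using AE_velocity_determines_dihedral_class[OF assms]
  proof eventually_elim
    case (elim p)
    show ?case
    proof
      assume p: "\<forall>i<m. p i \<in> {0<..<1}"
      \<comment> \<open>For almost every \<open>p\<close> a fibre is exactly one dihedral class, so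
        the bound becomes an equality.\<close>
      have "card (?F p (velocity m (p \<circ> \<tau>))) = 2 * m" if \<tau>: "\<tau> permutes {..<m}" for \<tau>
      proof -
        have "?F p (velocity m (p \<circ> \<tau>)) = (\<lambda>\<delta>. \<tau> \<circ> \<delta>) ` dihedrals m"
        proof
          show "?F p (velocity m (p \<circ> \<tau>)) \<subseteq> (\<lambda>\<delta>. \<tau> \<circ> \<delta>) ` dihedrals m"
            using elim p \<tau> by auto
        qed (use dihedral_class_subset_fibre[OF m0 _ \<tau>] p in blast)
        then show ?thesis
          using card_dihedral_class[OF assms \<tau>] by simp
      qed
      then have "fact m = 2 * m * num_velocities m p"
        unfolding fact_eq_sum_card_fibres[of m p] num_velocities_eq_card
        by (subst sum.cong[OF refl, where h = "\<lambda>_. 2 * m"]) auto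
      then have "fact (m - 1) = 2 * num_velocities m p"
        using m0 by (simp add: fact)
      then have "real (fact (m - 1)) = real (2 * num_velocities m p)"
        by (simp only:)
      moreover have "(fact m :: real) = real m * fact (m - 1)"
        using m0 by (rule fact_reduce)
      ultimately show "real (num_velocities m p) = fact m / (2 * real m) \<and>
          real (num_velocities m p) = fact (m - 1) / 2"
        using m0 by (simp add: field_simps)
    qed
  qed
qed

end
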